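(* There exists $\overline t>0$ such that if $t>\overline t$, then there exists $n\in\mathcal{A}$ with $$I(n)<0,$$ whereas any $m\in\mathcal{A}$ depending only on $z$, $m=m(z)$, satisfies $I(m)\geqslant0$.
   Context: Let $L_1,L_2,d,K>0$ be fixed, $\Omega=(-L_1,L_1)\times(-L_2,L_2)\times(0,d)\subset\mathbb{R}^3$ with coordinates $(x,y,z)$, and $$I(n)=\int_\Omega|\nabla n|^2+2t\,n\cdot\nabla\times n+t^2|n|^2\,dx+K\mathcal{H}^2(S_n),$$ $$\mathcal{A}=\left\{n\in SBV^2(\Omega,\mathbb{S}^2\cup\{0\}) : n|_{z=0}=e_1,\ n|_{z=d}=e_3,\ n|_{x=-L_1}=n|_{x=L_1},\ n|_{y=-L_2}=n|_{y=L_2}\right\}.$$ $SBV^2$ denotes the functions in $SBV$ with approximate gradient $\nabla n\in L^2$ and $\mathcal{H}^2(S_n)<\infty$, $S_n$ being the approximate discontinuity set. Boundary conditions are imposed in the weak (extended domain) sense: $n$ is extended by $e_1$ to $-\epsilon<z<0$ and by $e_3$ to $d<z<d+\epsilon$ for some fixed $\epsilon>0$, and periodically in $x,y$; $S_n$ is the discontinuity set of the extended map (counted once per period cell). Thus $n$ need not attain the boundary values or be periodic in the trace sense, but each part of the boundary where the condition fails belongs to $S_n$ and is charged by $K\mathcal{H}^2$. *)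

theory Defs
  imports "HOL-Analysis.Analysis"
begin

section \<open>Hausdorff measure\<close>

text \<open>
  The normalisation makes the \<open>k\<close>-dimensional measure agree with Lebesgue measure on
  \<open>k\<close>-planes. Boundedness is required because \<^const>\<open>diameter\<close> is meaningless for unbounded
  sets; empty covering sets cost nothing (this matters only for \<open>k = 0\<close>, where \<open>0 ^ 0 = 1\<close>).
\<close>

definition hausdorff_pre :: "nat \<Rightarrow> real \<Rightarrow> 'a::metric_space set \<Rightarrow> ennreal" where
  "hausdorff_pre k \<delta> S =
     (INF C \<in> {C :: nat \<Rightarrow> 'a set. S \<subseteq> (\<Union>i. C i) \<and> (\<forall>i. bounded (C i) \<and> diameter (C i) < \<delta>)}.
        (\<Sum>i. if C i = {} then 0
             else ennreal (unit_ball_vol (real k) * (diameter (C i) / 2) ^ k)))"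

definition hausdorff_measure :: "nat \<Rightarrow> 'a::metric_space set \<Rightarrow> ennreal" where
  "hausdorff_measure k S = (SUP \<delta> \<in> {0<..}. hausdorff_pre k \<delta> S)"

section \<open>Approximate limits and approximate gradients\<close>

definition has_approx_limit :: "(real^'n \<Rightarrow> real^'m) \<Rightarrow> real^'m \<Rightarrow> real^'n \<Rightarrow> bool" where
  "has_approx_limit u a x \<longleftrightarrow>
     ((\<lambda>r. (LINT y:ball x r|lebesgue. norm (u y - a)) / measure lebesgue (ball x r)) \<longlongrightarrow> 0)
       (at_right 0)"

definition approx_discontinuity_set :: "(real^'n) set \<Rightarrow> (real^'n \<Rightarrow> real^'m) \<Rightarrow> (real^'n) set" where
  "approx_discontinuity_set U u = {x \<in> U. \<not> (\<exists>a. has_approx_limit u a x)}"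

definition has_approx_derivative ::
    "(real^'n \<Rightarrow> real^'m) \<Rightarrow> real^'n^'m \<Rightarrow> real^'n \<Rightarrow> bool" where
  "has_approx_derivative u A x \<longleftrightarrow>
     (\<exists>a. has_approx_limit u a x \<and>
       ((\<lambda>r. (LINT y:ball x r|lebesgue. norm (u y - a - A *v (y - x)) / r)
              / measure lebesgue (ball x r)) \<longlongrightarrow> 0) (at_right 0))"

text \<open>
  The approximate gradient is unique where it exists, and it exists almost everywhere for
  functions of bounded variation. The value \<open>0\<close> at the remaining points is a convention.
  Entry \<open>(i, j)\<close> is the derivative of the \<open>i\<close>-th component in the \<open>j\<close>-th direction.
\<close>

definition approx_gradient :: "(real^'n \<Rightarrow> real^'m) \<Rightarrow> real^'n \<Rightarrow> real^'n^'m" where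
  "approx_gradient u x =
     (if \<exists>A. has_approx_derivative u A x then THE A. has_approx_derivative u A x else 0)"

section \<open>Special functions of bounded variation\<close>

text \<open>\<open>\<phi>\<close> is a compactly supported \<open>C\<^sup>1\<close> function on the open set \<open>U\<close> and \<open>D\<phi>\<close> its gradient.\<close>

definition test_function :: "(real^'n) set \<Rightarrow> (real^'n \<Rightarrow> real) \<Rightarrow> (real^'n \<Rightarrow> real^'n) \<Rightarrow> bool" where
  "test_function U \<phi> D\<phi> \<longleftrightarrow>
     (\<forall>x. (\<phi> has_derivative (\<lambda>h. D\<phi> x \<bullet> h)) (at x)) \<and> continuous_on UNIV D\<phi> \<and>
     compact (closure {x. \<phi> x \<noteq> 0}) \<and> closure {x. \<phi> x \<noteq> 0} \<subseteq> U"

text \<open>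
  The distributional derivative of \<open>u\<close> on \<open>U\<close> is a finite matrix-valued measure with Lebesgue
  decomposition \<open>Du = g L + D\<^sup>su\<close>, where \<open>L\<close> is Lebesgue measure. Since the library has no
  vector measures, the singular part is given by its polar decomposition \<open>D\<^sup>su = \<sigma> \<mu>\<close>: the
  finite Borel measure \<open>\<mu>\<close> is the total variation of \<open>D\<^sup>su\<close>, and \<open>\<sigma>\<close> has unit length.
\<close>

definition derivative_decomposition ::
    "(real^'n) set \<Rightarrow> (real^'n \<Rightarrow> real^'m) \<Rightarrow> (real^'n \<Rightarrow> real^'n^'m) \<Rightarrow>
     (real^'n) measure \<Rightarrow> (real^'n \<Rightarrow> real^'n^'m) \<Rightarrow> bool" where
  "derivative_decomposition U u g \<mu> \<sigma> \<longleftrightarrow>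
     g absolutely_integrable_on U \<and>
     finite_measure \<mu> \<and> sets \<mu> = sets borel \<and> emeasure \<mu> (- U) = 0 \<and>
     (\<exists>N \<in> null_sets lborel. emeasure \<mu> (- N) = 0) \<and>
     \<sigma> \<in> borel_measurable borel \<and> (AE x in \<mu>. norm (\<sigma> x) = 1) \<and>
     (\<forall>\<phi> D\<phi>. test_function U \<phi> D\<phi> \<longrightarrow>
        (\<forall>i j. (LINT x:U|lebesgue. u x $ i * D\<phi> x $ j) =
               - ((LINT x:U|lebesgue. \<phi> x * g x $ i $ j) + (LINT x|\<mu>. \<phi> x * \<sigma> x $ i $ j))))"

text \<open>
  The Cantor part of \<open>Du\<close> is the restriction of \<open>D\<^sup>su\<close> to the complement of the approximate
  discontinuity set; \<open>SBV\<close> asks that it vanish.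
\<close>

definition SBV :: "(real^'n) set \<Rightarrow> (real^'n \<Rightarrow> real^'m) set" where
  "SBV U = {u. u absolutely_integrable_on U \<and>
     (\<exists>g \<mu> \<sigma>. derivative_decomposition U u g \<mu> \<sigma> \<and>
        (AE x in \<mu>. x \<in> approx_discontinuity_set U u))}"

definition SBV2 :: "(real^'n) set \<Rightarrow> (real^'n \<Rightarrow> real^'m) set" where
  "SBV2 U = {u \<in> SBV U.
     set_borel_measurable lebesgue U (approx_gradient u) \<and>
     set_integrable lebesgue U (\<lambda>x. (norm (approx_gradient u x))\<^sup>2) \<and>
     hausdorff_measure (CARD('n) - 1) (approx_discontinuity_set U u) < \<infinity>}"

section \<open>The variational problem\<close>

definition Omega :: "real \<Rightarrow> real \<Rightarrow> real \<Rightarrow> (real^3) set" where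
  "Omega L1 L2 d = {p. - L1 < p $ 1 \<and> p $ 1 < L1 \<and> - L2 < p $ 2 \<and> p $ 2 < L2 \<and> 0 < p $ 3 \<and> p $ 3 < d}"

definition slab :: "real \<Rightarrow> real \<Rightarrow> (real^3) set" where
  "slab d \<epsilon> = {p. - \<epsilon> < p $ 3 \<and> p $ 3 < d + \<epsilon>}"

text \<open>The representative of \<open>s\<close> modulo \<open>2L\<close> in \<open>[-L, L)\<close>.\<close>

definition wrap :: "real \<Rightarrow> real \<Rightarrow> real" where
  "wrap L s = s - 2 * L * real_of_int \<lfloor>(s + L) / (2 * L)\<rfloor>"

text \<open>
  The extension of a map on \<open>\<Omega>\<close> that carries the boundary conditions. On the lateral faces of
  the period cells it takes values of \<open>n\<close> outside \<open>\<Omega>\<close>, but these faces are Lebesgue null sets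
  and do not affect approximate limits.
\<close>

definition extend :: "real \<Rightarrow> real \<Rightarrow> real \<Rightarrow> (real^3 \<Rightarrow> real^3) \<Rightarrow> real^3 \<Rightarrow> real^3" where
  "extend L1 L2 d n p =
     (if p $ 3 \<le> 0 then axis 1 1
      else if d \<le> p $ 3 then axis 3 1
      else n (vector [wrap L1 (p $ 1), wrap L2 (p $ 2), p $ 3]))"

text \<open>The half-open period cell counts periodic copies of the same point once.\<close>

definition jump_set :: "real \<Rightarrow> real \<Rightarrow> real \<Rightarrow> real \<Rightarrow> (real^3 \<Rightarrow> real^3) \<Rightarrow> (real^3) set" where
  "jump_set L1 L2 d \<epsilon> n =
     approx_discontinuity_set (slab d \<epsilon>) (extend L1 L2 d n) \<inter>
     {p. - L1 \<le> p $ 1 \<and> p $ 1 < L1 \<and> - L2 \<le> p $ 2 \<and> p $ 2 < L2}"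

text \<open>
  Weak boundary conditions: the extended map is required to be locally \<open>SBV\<^sup>2\<close> on the extended
  domain. Bounded open subsets are used because a periodic function is not integrable on the
  whole slab.
\<close>

definition admissible :: "real \<Rightarrow> real \<Rightarrow> real \<Rightarrow> real \<Rightarrow> (real^3 \<Rightarrow> real^3) set" where
  "admissible L1 L2 d \<epsilon> =
     {n \<in> SBV2 (Omega L1 L2 d).
        (AE p in lebesgue_on (Omega L1 L2 d). n p \<in> sphere 0 1 \<union> {0}) \<and>
        (\<forall>U. open U \<and> bounded U \<and> U \<subseteq> slab d \<epsilon> \<longrightarrow> extend L1 L2 d n \<in> SBV2 U)}"

definition curl_of_gradient :: "real^3^3 \<Rightarrow> real^3" where
  "curl_of_gradient A = vector [A $ 3 $ 2 - A $ 2 $ 3, A $ 1 $ 3 - A $ 3 $ 1, A $ 2 $ 1 - A $ 1 $ 2]"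

text \<open>
  The norm on \<^typ>\<open>real^3^3\<close> is the Frobenius norm. For admissible \<open>n\<close> the Hausdorff measure below
  is finite, so \<^const>\<open>enn2real\<close> loses nothing.
\<close>

definition energy :: "real \<Rightarrow> real \<Rightarrow> real \<Rightarrow> real \<Rightarrow> real \<Rightarrow> real \<Rightarrow> (real^3 \<Rightarrow> real^3) \<Rightarrow> real" where
  "energy L1 L2 d \<epsilon> K t n =
     (LINT p:Omega L1 L2 d|lebesgue.
        (norm (approx_gradient n p))\<^sup>2
        + 2 * t * (n p \<bullet> curl_of_gradient (approx_gradient n p))
        + t\<^sup>2 * (norm (n p))\<^sup>2)
     + K * enn2real (hausdorff_measure 2 (jump_set L1 L2 d \<epsilon> n))"

definition depends_only_on_z :: "real \<Rightarrow> real \<Rightarrow> real \<Rightarrow> (real^3 \<Rightarrow> real^3) \<Rightarrow> bool" where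
  "depends_only_on_z L1 L2 d m \<longleftrightarrow>
     (\<exists>f :: real \<Rightarrow> real^3. AE p in lebesgue_on (Omega L1 L2 d). m p = f (p $ 3))"

end

theory Submission
  imports Defs
begin

text \<open>
  A double twist has negative energy: the unit field
  \<open>(Y, - X, sqrt (1 - X\<^sup>2 - Y\<^sup>2))\<close> with \<open>X = t x\<close>, \<open>Y = t y\<close> has energy density
  \<open>t\<^sup>2 (3 + S / w\<^sup>2 - 2 S / w - 4 w)\<close>, where \<open>S = X\<^sup>2 + Y\<^sup>2\<close> and \<open>w\<close> is the third component,
  which is at most \<open>- t\<^sup>2 / 4\<close> for \<open>\<bar>X\<bar>, \<bar>Y\<bar> \<le> 1 / 4\<close>. Tiling \<open>\<Omega>\<close> periodically by rectangular columns of width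
  comparable to \<open>1 / t\<close> carrying this field gains order \<open>t\<^sup>2\<close> in the bulk, while the jump set consists of
  \<open>O(t)\<close> plane pieces and costs only order \<open>t\<close>.

  For a map of \<open>z\<close> alone the first two columns of the approximate gradient vanish, and the energy
  density becomes the sum of squares
  \<open>(m\<^sub>1' + t m\<^sub>2)\<^sup>2 + (m\<^sub>2' - t m\<^sub>1)\<^sup>2 + (m\<^sub>3')\<^sup>2 + t\<^sup>2 m\<^sub>3\<^sup>2\<close>.
\<close>

section \<open>Averages over balls\<close>

text \<open>On the axis of a column, where \<open>X = Y = 0\<close>, the field turns in both
  horizontal directions at once: the squared gradient gives 2 t^2, the curl term -4 t^2 and the
  zero-order term t^2, in total -t^2. A twist in a single direction only balances, t^2 - 2 t^2 + t^2
  = 0. The handedness \<open>(Y, - X)\<close> makes the curl term negative, and the bound 1/4 keeps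
  \<open>w\<close> above 9/10, which preserves the gain off the axis. The work lies in the
  definitions. The approximate gradient is a definite description, so it can be evaluated only once
  approximate derivatives are known to be unique. Membership in SBV requires an explicit
  decomposition of the distributional derivative whose singular part charges only true discontinuity
  points. Columns aligned with the axes put all jumps on coordinate planes, so that the Gauss-Green
  formula reduces to integration by parts on coordinate lines. The half-widths divide
  \<open>L1\<close> and \<open>L2\<close>, and the boundary values are built into the field, so it
  coincides with its own extension.\<close>

lemma lebesgue_distr_plus: "distr lebesgue lebesgue (\<lambda>x. x + a) = (lebesgue :: 'a::euclidean_space measure)"
proof -
  have "lebesgue = density (distr lebesgue lebesgue (\<lambda>x::'a. a + (\<Sum>j\<in>Basis. (1 * (x \<bullet> j)) *\<^sub>R j))) (\<lambda>_. ennreal (\<Prod>j\<in>(Basis::'a set). \<bar>1::real\<bar>))"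
    by (rule lebesgue_affine_euclidean) auto
  then show ?thesis
    by (simp add: euclidean_representation density_1 add.commute)
qed

lemma measurable_lebesgue_plus: "(\<lambda>x. x + a) \<in> lebesgue \<rightarrow>\<^sub>M (lebesgue :: 'a::euclidean_space measure)"
  using lebesgue_affine_measurable[of "\<lambda>_. 1" a] by (simp add: euclidean_representation add.commute)

lemma AE_lebesgue_plus:
  fixes a :: "'a::euclidean_space"
  assumes "AE x in lebesgue. P x"
  shows "AE x in lebesgue. P (x + a)"
proof -
  have "AE x in distr lebesgue lebesgue (\<lambda>x. x + a). P x"
    unfolding lebesgue_distr_plus by fact
  then show ?thesis
    by (rule AE_distrD[OF measurable_lebesgue_plus])
qed

lemma set_integral_ball_plus:
  fixes f :: "'a::euclidean_space \<Rightarrow> real"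
  assumes "set_integrable lebesgue (ball (x + a) r) f"
  shows "set_integrable lebesgue (ball x r) (\<lambda>y. f (y + a))"
    and "(LINT y:ball x r|lebesgue. f (y + a)) = (LINT y:ball (x + a) r|lebesgue. f y)"
proof -
  let ?g = "\<lambda>y. indicator (ball (x + a) r) y *\<^sub>R f y"
  have g: "integrable lebesgue ?g"
    using assms by (simp add: set_integrable_def)
  then have m: "?g \<in> borel_measurable lebesgue" by auto
  have eq: "?g (y + a) = indicator (ball x r) y *\<^sub>R f (y + a)" for y
    by (simp add: indicator_def dist_norm)
  have "integrable (distr lebesgue lebesgue (\<lambda>x. x + a)) ?g"
    using g by (simp add: lebesgue_distr_plus)
  then have "integrable lebesgue (\<lambda>y. ?g (y + a))"
    using integrable_distr_eq[OF measurable_lebesgue_plus m] by simp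
  then show "set_integrable lebesgue (ball x r) (\<lambda>y. f (y + a))"
    unfolding eq set_integrable_def .
  have "(LINT y|distr lebesgue lebesgue (\<lambda>x. x + a). ?g y) = (LINT y|lebesgue. ?g (y + a))"
    by (rule integral_distr[OF measurable_lebesgue_plus m])
  then show "(LINT y:ball x r|lebesgue. f (y + a)) = (LINT y:ball (x + a) r|lebesgue. f y)"
    unfolding eq set_lebesgue_integral_def lebesgue_distr_plus by simp
qed

lemma set_integral_const_ball:
  "(LINT y:ball x r|lebesgue. c) = (c::real) * measure lebesgue (ball (x::'a::euclidean_space) r)"
  using lmeasurable_ball[of x r]
  by (simp add: set_lebesgue_integral_def fmeasurable_def mult.commute less_top[symmetric])

lemma measure_ball_half:
  fixes x z :: "real^'n"
  assumes "r > 0"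
  shows "measure lebesgue (ball z (r/2)) = measure lebesgue (ball x r) / 2 ^ CARD('n)"
  using assms by (simp add: content_ball power_divide)

text \<open>A function and its translate cannot both be small on a ball when their sum is large on a
  smaller one. Non-uniqueness of approximate limits, non-uniqueness of approximate derivatives, and
  jumps are all excluded or detected in this way.\<close>

lemma ball_average_lower_bound:
  fixes f :: "real^'n \<Rightarrow> real"
  assumes r: "r > 0" and int: "set_integrable lebesgue (ball x r) f" and nn: "\<And>y. f y \<ge> 0"
    and v: "norm v \<le> r / 2" and w: "norm w \<le> r / 2"
    and lb: "AE y in lebesgue. y \<in> ball (x + v) (r / 2) \<longrightarrow> c \<le> f y + f (y + (w - v))"
  shows "c / (2 * 2 ^ CARD('n)) \<le> (LINT y:ball x r|lebesgue. f y) / measure lebesgue (ball x r)"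
proof -
  let ?B = "ball x r" and ?V = "ball (x + v) (r / 2)" and ?W = "ball (x + w) (r / 2)"
  have sub: "ball (x + u) (r / 2) \<subseteq> ?B" if "norm u \<le> r / 2" for u
    using that by (subst ball_subset_ball_iff) (auto simp: dist_norm)
  have iV: "set_integrable lebesgue ?V f" and iW: "set_integrable lebesgue ?W f"
    by (rule set_integrable_subset[OF int]; use sub v w in auto)+
  have eqW: "?W = ball ((x + v) + (w - v)) (r / 2)" by simp
  have iW': "set_integrable lebesgue ?V (\<lambda>y. f (y + (w - v)))"
    and eW: "(LINT y:?V|lebesgue. f (y + (w - v))) = (LINT y:?W|lebesgue. f y)"
    using set_integral_ball_plus[of "x + v" "w - v" "r/2" f] iW by (simp_all)
  have le: "(LINT y:ball (x + u) (r / 2)|lebesgue. f y) \<le> (LINT y:?B|lebesgue. f y)"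
    if "norm u \<le> r / 2" for u
    unfolding set_lebesgue_integral_def
  proof (rule integral_mono_AE)
    show "integrable lebesgue (\<lambda>y. indicat_real (ball (x + u) (r / 2)) y *\<^sub>R f y)"
      using set_integrable_subset[OF int _ sub[OF that]] by (simp add: set_integrable_def)
    show "integrable lebesgue (\<lambda>y. indicat_real ?B y *\<^sub>R f y)"
      using int by (simp add: set_integrable_def)
    show "AE y in lebesgue. indicat_real (ball (x + u) (r / 2)) y *\<^sub>R f y \<le> indicat_real ?B y *\<^sub>R f y"
      using sub[OF that] nn by (intro AE_I2) (auto simp: indicator_def)
  qed
  have "c * measure lebesgue ?V = (LINT y:?V|lebesgue. c)"
    by (rule set_integral_const_ball[symmetric])
  also have "\<dots> \<le> (LINT y:?V|lebesgue. f y + f (y + (w - v)))"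
    unfolding set_lebesgue_integral_def
  proof (rule integral_mono_AE)
    show "integrable lebesgue (\<lambda>y. indicat_real ?V y *\<^sub>R c)"
      unfolding set_integrable_def[symmetric] by (rule absolutely_integrable_on_const[OF lmeasurable_ball])
    show "integrable lebesgue (\<lambda>y. indicat_real ?V y *\<^sub>R (f y + f (y + (w - v))))"
      using set_integral_add(1)[OF iV iW'] by (simp add: set_integrable_def)
    show "AE y in lebesgue. indicat_real ?V y *\<^sub>R c \<le> indicat_real ?V y *\<^sub>R (f y + f (y + (w - v)))"
      using lb by eventually_elim (auto simp: indicator_def)
  qed
  also have "\<dots> = (LINT y:?V|lebesgue. f y) + (LINT y:?W|lebesgue. f y)"
    by (simp add: set_integral_add(2)[OF iV iW'] eW)
  \<comment> \<open>The two half-radius balls lie in \<open>?B\<close> but may overlap, so each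
    integral is bounded separately by the full one. This is the factor 2; the factor
    \<open>2 ^ CARD('n)\<close> comes from halving the radius.\<close>
  also have "\<dots> \<le> 2 * (LINT y:?B|lebesgue. f y)"
    using le[OF v] le[OF w] by simp
  finally have "c * (measure lebesgue ?B / 2 ^ CARD('n)) \<le> 2 * (LINT y:?B|lebesgue. f y)"
    by (simp only: measure_ball_half[OF r, of _ x])
  moreover have "measure lebesgue ?B > 0"
    using r by (simp add: content_ball_pos)
  ultimately show ?thesis
    by (simp add: field_simps)
qed

text \<open>No measurability is assumed: if \<open>f\<close> is not integrable, its integral is 0 by
  convention, and \<open>e \<ge> 0\<close> covers this case.\<close>

lemma ball_average_upper_bound:
  fixes f :: "real^'n \<Rightarrow> real"
  assumes r: "r > 0" and e: "e \<ge> 0" and ub: "\<And>y. y \<in> ball x r \<Longrightarrow> f y \<le> e"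
  shows "(LINT y:ball x r|lebesgue. f y) / measure lebesgue (ball x r) \<le> e"
proof (cases "set_integrable lebesgue (ball x r) f")
  case True
  have "(LINT y:ball x r|lebesgue. f y) \<le> (LINT y:ball x r|lebesgue. e)"
    by (rule set_integral_mono[OF True])
       (auto simp: ub intro: absolutely_integrable_on_const)
  also have "\<dots> = e * measure lebesgue (ball x r)"
    by (rule set_integral_const_ball)
  finally show ?thesis
    using r by (simp add: content_ball_pos field_simps)
next
  case False
  then show ?thesis
    using e by (simp add: set_lebesgue_integral_def set_integrable_def not_integrable_integral_eq)
qed

lemma eventually_absolutely_integrable_ball:
  fixes u :: "real^'n \<Rightarrow> real^'m"
  assumes "u absolutely_integrable_on U" "open U" "x \<in> U"
  shows "\<forall>\<^sub>F r in at_right 0. u absolutely_integrable_on ball x r"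
proof -
  obtain e where e: "e > 0" "ball x e \<subseteq> U"
    using assms openE by blast
  show ?thesis
    unfolding eventually_at_right_field
  proof (intro exI[of _ e] conjI allI impI)
    fix r :: real assume "0 < r" "r < e"
    then have "ball x r \<subseteq> U"
      using e subset_ball[of r e x] by auto
    then show "u absolutely_integrable_on ball x r"
      by (rule set_integrable_subset[OF assms(1), rotated]) auto
  qed (use e in auto)
qed

lemma absolutely_integrable_matrix_vector_ball:
  fixes A :: "real^'n^'m"
  shows "(\<lambda>y. A *v (y - x)) absolutely_integrable_on ball x r"
proof -
  obtain a where a: "ball x r \<subseteq> cbox (-a) a"
    using bounded_subset_cbox_symmetric[OF bounded_ball] by blast
  have "(\<lambda>y. A *v (y - x)) absolutely_integrable_on cbox (-a) a"
    by (intro absolutely_integrable_continuous bounded_linear.continuous_on[OF matrix_vector_mul_bounded_linear] continuous_intros)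
  then show ?thesis
    by (rule set_integrable_subset) (use a in auto)
qed

lemma eventually_integrable_remainder:
  fixes u :: "real^'n \<Rightarrow> real^'m"
  assumes "\<forall>\<^sub>F r in at_right 0. u absolutely_integrable_on ball x r"
  shows "\<forall>\<^sub>F r in at_right 0. set_integrable lebesgue (ball x r) (\<lambda>y. norm (u y - a - A *v (y - x)) / r)"
  using assms
proof eventually_elim
  case (elim r)
  have "(\<lambda>y. u y - a - A *v (y - x)) absolutely_integrable_on ball x r"
    by (intro set_integral_diff(1) elim absolutely_integrable_on_const absolutely_integrable_matrix_vector_ball) auto
  then show ?case
    by (intro set_integrable_divide set_integrable_norm)
qed

lemma eventually_integrable_deviation:
  fixes u :: "real^'n \<Rightarrow> real^'m"
  assumes "\<forall>\<^sub>F r in at_right 0. u absolutely_integrable_on ball x r"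
  shows "\<forall>\<^sub>F r in at_right 0. set_integrable lebesgue (ball x r) (\<lambda>y. norm (u y - a))"
  using assms
proof eventually_elim
  case (elim r)
  then show ?case
    by (intro set_integrable_norm set_integral_diff(1) absolutely_integrable_on_const) auto
qed

text \<open>The form used in all later tests. The integrand may depend on \<open>r\<close>, because
  remainders are scaled by 1/r, and so may the shifts \<open>v\<close> and \<open>w\<close>; only
  \<open>c\<close> must be uniform in \<open>r\<close>.\<close>

lemma ball_averages_vanish_lower_bound:
  fixes f :: "real \<Rightarrow> real^'n \<Rightarrow> real"
  assumes lim: "((\<lambda>r. (LINT y:ball x r|lebesgue. f r y) / measure lebesgue (ball x r)) \<longlongrightarrow> 0) (at_right 0)"
    and int: "\<forall>\<^sub>F r in at_right 0. set_integrable lebesgue (ball x r) (f r)"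
    and nn: "\<And>r y. r > 0 \<Longrightarrow> f r y \<ge> 0"
    and lb: "\<forall>\<^sub>F r in at_right 0. \<exists>v w. norm v \<le> r / 2 \<and> norm w \<le> r / 2 \<and>
      (AE y in lebesgue. y \<in> ball (x + v) (r / 2) \<longrightarrow> c \<le> f r y + f r (y + (w - v)))"
  shows "c \<le> 0"
proof -
  have "\<forall>\<^sub>F r in at_right 0. c / (2 * 2 ^ CARD('n)) \<le>
      (LINT y:ball x r|lebesgue. f r y) / measure lebesgue (ball x r)"
    using int lb eventually_at_right_less[of 0]
  proof eventually_elim
    case (elim r)
    then show ?case
      using ball_average_lower_bound[of r x "f r" _ _ c] nn by blast
  qed
  then have "c / (2 * 2 ^ CARD('n)) \<le> 0"
    by (rule tendsto_lowerbound[OF lim]) simp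
  moreover have "(0::real) < 2 * 2 ^ CARD('n)"
    by simp
  ultimately show ?thesis
    using pos_divide_le_eq[of "2 * 2 ^ CARD('n)" c 0] by (metis mult_zero_left)
qed

lemma ball_average_add_tendsto_0:
  fixes f g h :: "real \<Rightarrow> real^'n \<Rightarrow> real"
  assumes f: "((\<lambda>r. (LINT y:ball x r|lebesgue. f r y) / measure lebesgue (ball x r)) \<longlongrightarrow> 0) (at_right 0)"
    and g: "((\<lambda>r. (LINT y:ball x r|lebesgue. g r y) / measure lebesgue (ball x r)) \<longlongrightarrow> 0) (at_right 0)"
    and intf: "\<forall>\<^sub>F r in at_right 0. set_integrable lebesgue (ball x r) (f r)"
    and intg: "\<forall>\<^sub>F r in at_right 0. set_integrable lebesgue (ball x r) (g r)"
  shows "((\<lambda>r. (LINT y:ball x r|lebesgue. f r y + g r y) / measure lebesgue (ball x r)) \<longlongrightarrow> 0) (at_right 0)"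
proof -
  have "\<forall>\<^sub>F r in at_right 0.
      (LINT y:ball x r|lebesgue. f r y) / measure lebesgue (ball x r)
      + (LINT y:ball x r|lebesgue. g r y) / measure lebesgue (ball x r)
      = (LINT y:ball x r|lebesgue. f r y + g r y) / measure lebesgue (ball x r)"
    using intf intg by eventually_elim (simp add: set_integral_add add_divide_distrib)
  from tendsto_cong[THEN iffD1, OF this tendsto_add[OF f g]] show ?thesis by simp
qed

section \<open>Uniqueness of approximate limits and derivatives, and tests for jumps\<close>

text \<open>Here \<open>v = w = 0\<close>, and the triangle inequality, counted twice, gives the
  constant \<open>2 * norm (a - b)\<close>. Integrability on small balls is essential: a
  non-integrable deviation has integral 0, so that any value would pass as a limit.\<close>

lemma has_approx_limit_unique:
  fixes u :: "real^'n \<Rightarrow> real^'m"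
  assumes a: "has_approx_limit u a x" and b: "has_approx_limit u b x"
    and int: "\<forall>\<^sub>F r in at_right 0. u absolutely_integrable_on ball x r"
  shows "a = b"
proof -
  have int2: "\<forall>\<^sub>F r in at_right 0. set_integrable lebesgue (ball x r) (\<lambda>y. norm (u y - a) + norm (u y - b))"
    using eventually_integrable_deviation[OF int, of a] eventually_integrable_deviation[OF int, of b]
    by eventually_elim (rule set_integral_add(1))
  have "2 * norm (a - b) \<le> 0"
  proof (rule ball_averages_vanish_lower_bound)
    show "((\<lambda>r. (LINT y:ball x r|lebesgue. norm (u y - a) + norm (u y - b)) / measure lebesgue (ball x r)) \<longlongrightarrow> 0) (at_right 0)"
      by (rule ball_average_add_tendsto_0)
         (use a b int eventually_integrable_deviation in \<open>auto simp: has_approx_limit_def\<close>)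
    show "\<forall>\<^sub>F r in at_right 0. \<exists>v w. norm v \<le> r / 2 \<and> norm w \<le> r / 2 \<and>
      (AE y in lebesgue. y \<in> ball (x + v) (r / 2) \<longrightarrow> 2 * norm (a - b) \<le>
        (norm (u y - a) + norm (u y - b)) + (norm (u (y + (w - v)) - a) + norm (u (y + (w - v)) - b)))"
      using eventually_at_right_less[of 0]
    proof eventually_elim
      case (elim r)
      have "2 * norm (a - b) \<le> (norm (u y - a) + norm (u y - b)) + (norm (u y - a) + norm (u y - b))" for y
        using norm_triangle_ineq4[of "u y - a" "u y - b"] by (simp add: norm_minus_commute)
      then show ?case
        using elim by (intro exI[of _ 0]) auto
    qed
  qed (use int2 in auto)
  then show ?thesis by simp
qed

text \<open>Whatever \<open>a\<close> is, the triangle inequality distributes the gap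
  \<open>c\<close> over the deviations from \<open>a\<close> at \<open>y\<close> and at its
  translate, so they cannot both be small on average.\<close>

lemma jump_no_approx_limit:
  fixes u :: "real^'n \<Rightarrow> real^'m"
  assumes int: "\<forall>\<^sub>F r in at_right 0. u absolutely_integrable_on ball x r" and c: "c > 0"
    and jump: "\<forall>\<^sub>F r in at_right 0. \<exists>v w. norm v \<le> r / 2 \<and> norm w \<le> r / 2 \<and>
      (\<forall>y \<in> ball (x + v) (r / 2). c \<le> norm (u y - u (y + (w - v))))"
  shows "\<not> has_approx_limit u a x"
proof
  assume a: "has_approx_limit u a x"
  have "c \<le> 0"
  proof (rule ball_averages_vanish_lower_bound)
    show "((\<lambda>r. (LINT y:ball x r|lebesgue. norm (u y - a)) / measure lebesgue (ball x r)) \<longlongrightarrow> 0) (at_right 0)"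
      using a by (simp add: has_approx_limit_def)
    show "\<forall>\<^sub>F r in at_right 0. \<exists>v w. norm v \<le> r / 2 \<and> norm w \<le> r / 2 \<and>
      (AE y in lebesgue. y \<in> ball (x + v) (r / 2) \<longrightarrow> c \<le> norm (u y - a) + norm (u (y + (w - v)) - a))"
      using jump
    proof eventually_elim
      case (elim r)
      then obtain v w where vw: "norm v \<le> r / 2" "norm w \<le> r / 2"
        "\<forall>y \<in> ball (x + v) (r / 2). c \<le> norm (u y - u (y + (w - v)))" by blast
      have "c \<le> norm (u y - a) + norm (u (y + (w - v)) - a)" if "y \<in> ball (x + v) (r / 2)" for y
        using norm_triangle_ineq4[of "u y - a" "u (y + (w - v)) - a"] bspec[OF vw(3) that] by simp
      then show ?case
        using vw(1,2) by - (rule exI[of _ v], rule exI[of _ w], auto intro!: AE_I2)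
    qed
  qed (use eventually_integrable_deviation[OF int] in auto)
  then show False using c by simp
qed

text \<open>Translation by \<open>(r / 2) *\<^sub>R e\<close> leaves \<open>u\<close> unchanged but
  moves the linear part by \<open>(r / 2) *\<^sub>R (A *v e)\<close>. After division by
  \<open>r\<close> a gap \<open>norm (A *v e) / 2\<close> independent of \<open>r\<close> remains.
  No smoothness of \<open>u\<close> is involved.\<close>

lemma has_approx_derivative_invariant_direction:
  fixes u :: "real^'n \<Rightarrow> real^'m"
  assumes A: "has_approx_derivative u A x"
    and int: "\<forall>\<^sub>F r in at_right 0. u absolutely_integrable_on ball x r"
    and e: "norm e = 1"
    and inv: "\<forall>\<^sub>F r in at_right 0. AE y in lebesgue. y \<in> ball x (r / 2) \<longrightarrow> u (y + (r / 2) *\<^sub>R e) = u y"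
  shows "A *v e = 0"
proof -
  obtain a where a: "((\<lambda>r. (LINT y:ball x r|lebesgue. norm (u y - a - A *v (y - x)) / r)
              / measure lebesgue (ball x r)) \<longlongrightarrow> 0) (at_right 0)"
    using A unfolding has_approx_derivative_def by blast
  have "norm (A *v e) / 2 \<le> 0"
  proof (rule ball_averages_vanish_lower_bound[OF a eventually_integrable_remainder[OF int]])
    show "\<forall>\<^sub>F r in at_right 0. \<exists>v w. norm v \<le> r / 2 \<and> norm w \<le> r / 2 \<and>
      (AE y in lebesgue. y \<in> ball (x + v) (r / 2) \<longrightarrow> norm (A *v e) / 2 \<le>
        norm (u y - a - A *v (y - x)) / r + norm (u (y + (w - v)) - a - A *v (y + (w - v) - x)) / r)"
      using inv eventually_at_right_less[of 0]
    proof eventually_elim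
      case (elim r)
      have *: "norm (A *v e) / 2 \<le>
          norm (u y - a - A *v (y - x)) / r + norm (u y - a - A *v (y + (r / 2) *\<^sub>R e - x)) / r" for y
      proof -
        have "(u y - a - A *v (y - x)) - (u y - a - A *v (y + (r / 2) *\<^sub>R e - x)) = (r / 2) *\<^sub>R (A *v e)"
          by (simp add: matrix_vector_mult_diff_distrib matrix_vector_right_distrib scaleR_matrix_vector_assoc
              matrix_vector_mult_scaleR)
        then have "(r / 2) * norm (A *v e) \<le>
          norm (u y - a - A *v (y - x)) + norm (u y - a - A *v (y + (r / 2) *\<^sub>R e - x))"
          using norm_triangle_ineq4[of "u y - a - A *v (y - x)" "u y - a - A *v (y + (r / 2) *\<^sub>R e - x)"] elim
          by simp
        then show ?thesis
          using elim by (simp add: field_simps)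
      qed
      show ?case
      proof (rule exI[of _ 0], rule exI[of _ "(r/2) *\<^sub>R e"], intro conjI)
        show "AE y in lebesgue. y \<in> ball (x + 0) (r / 2) \<longrightarrow> norm (A *v e) / 2 \<le>
          norm (u y - a - A *v (y - x)) / r
          + norm (u (y + ((r/2) *\<^sub>R e - 0)) - a - A *v (y + ((r/2) *\<^sub>R e - 0) - x)) / r"
          using elim(1) by eventually_elim (use * in auto)
      qed (use e elim in auto)
    qed
  qed auto
  then show ?thesis by simp
qed

text \<open>Each derivative carries its own existentially bound limit, so the two limits are
  identified before the remainders are compared. The sum of the remainders then dominates
  \<open>norm ((A - B) *v (y - x)) / r\<close>; at \<open>y\<close> itself this may vanish, but not
  both there and at the translate by \<open>(r / 2) *\<^sub>R e\<close>.\<close>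

lemma has_approx_derivative_unique:
  fixes u :: "real^'n \<Rightarrow> real^'m"
  assumes A: "has_approx_derivative u A x" and B: "has_approx_derivative u B x"
    and int: "\<forall>\<^sub>F r in at_right 0. u absolutely_integrable_on ball x r"
  shows "A = B"
proof -
  let ?rem = "\<lambda>a A r y. norm (u y - a - A *v (y - x)) / r"
  obtain a where a: "has_approx_limit u a x"
    and A': "((\<lambda>r. (LINT y:ball x r|lebesgue. ?rem a A r y) / measure lebesgue (ball x r)) \<longlongrightarrow> 0) (at_right 0)"
    using A unfolding has_approx_derivative_def by blast
  obtain b where b: "has_approx_limit u b x"
    and B': "((\<lambda>r. (LINT y:ball x r|lebesgue. ?rem b B r y) / measure lebesgue (ball x r)) \<longlongrightarrow> 0) (at_right 0)"
    using B unfolding has_approx_derivative_def by blast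
  have [simp]: "b = a"
    using has_approx_limit_unique[OF b a int] .
  have intA: "\<forall>\<^sub>F r in at_right 0. set_integrable lebesgue (ball x r) (?rem a A r)"
    and intB: "\<forall>\<^sub>F r in at_right 0. set_integrable lebesgue (ball x r) (?rem a B r)"
    by (rule eventually_integrable_remainder[OF int])+
  have lim: "((\<lambda>r. (LINT y:ball x r|lebesgue. ?rem a A r y + ?rem a B r y) / measure lebesgue (ball x r)) \<longlongrightarrow> 0) (at_right 0)"
    using A' B' intA intB by (intro ball_average_add_tendsto_0) auto
  have "A *v e = B *v e" if e: "norm e = 1" for e
  proof -
    have "norm ((A - B) *v e) / 2 \<le> 0"
    proof (rule ball_averages_vanish_lower_bound[OF lim])
      show "\<forall>\<^sub>F r in at_right 0. set_integrable lebesgue (ball x r) (\<lambda>y. ?rem a A r y + ?rem a B r y)"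
        using intA intB by eventually_elim (rule set_integral_add(1))
      show "\<forall>\<^sub>F r in at_right 0. \<exists>v w. norm v \<le> r / 2 \<and> norm w \<le> r / 2 \<and>
        (AE y in lebesgue. y \<in> ball (x + v) (r / 2) \<longrightarrow> norm ((A - B) *v e) / 2 \<le>
          (?rem a A r y + ?rem a B r y) + (?rem a A r (y + (w - v)) + ?rem a B r (y + (w - v))))"
        using eventually_at_right_less[of 0]
      proof eventually_elim
        case (elim r)
        have **: "norm ((A - B) *v (z - x)) / r \<le> ?rem a A r z + ?rem a B r z" for z
          using norm_triangle_ineq4[of "u z - a - B *v (z - x)" "u z - a - A *v (z - x)"] elim
          by (simp add: matrix_vector_mult_diff_rdistrib divide_right_mono flip: add_divide_distrib)
        have "norm ((A - B) *v e) / 2 \<le>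
            norm ((A - B) *v (y - x)) / r + norm ((A - B) *v (y + (r / 2) *\<^sub>R e - x)) / r" for y
        proof -
          have "(A - B) *v (y + (r / 2) *\<^sub>R e - x) - (A - B) *v (y - x) = (r / 2) *\<^sub>R ((A - B) *v e)"
            by (simp add: matrix_vector_mult_diff_distrib matrix_vector_right_distrib matrix_vector_mult_scaleR)
          then have "(r / 2) * norm ((A - B) *v e) \<le>
              norm ((A - B) *v (y + (r / 2) *\<^sub>R e - x)) + norm ((A - B) *v (y - x))"
            using norm_triangle_ineq4[of "(A - B) *v (y + (r / 2) *\<^sub>R e - x)" "(A - B) *v (y - x)"] elim
            by simp
          then show ?thesis
            using elim by (simp add: field_simps)
        qed
        then have "norm ((A - B) *v e) / 2 \<le> (?rem a A r y + ?rem a B r y)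
            + (?rem a A r (y + (r / 2) *\<^sub>R e) + ?rem a B r (y + (r / 2) *\<^sub>R e))" for y
          using **[of y] **[of "y + (r / 2) *\<^sub>R e"] by (meson add_mono order_trans)
        then show ?case
          using e elim by - (rule exI[of _ 0], rule exI[of _ "(r/2) *\<^sub>R e"], auto)
      qed
    qed auto
    then show ?thesis by (simp add: matrix_vector_mult_diff_rdistrib)
  qed
  then have "A *v axis j 1 = B *v axis j 1" for j
    by simp
  then show ?thesis
    by (simp add: matrix_vector_mult_basis column_def vec_eq_iff)
qed

lemma approx_gradient_eqI:
  fixes u :: "real^'n \<Rightarrow> real^'m"
  assumes "has_approx_derivative u A x" "\<forall>\<^sub>F r in at_right 0. u absolutely_integrable_on ball x r"
  shows "approx_gradient u x = A"
  unfolding approx_gradient_def using assms has_approx_derivative_unique by (auto intro!: the_equality)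

section \<open>Classical continuity and differentiability imply the approximate notions\<close>

lemma isCont_has_approx_limit:
  fixes u :: "real^'n \<Rightarrow> real^'m"
  assumes "isCont u x"
  shows "has_approx_limit u (u x) x"
  unfolding has_approx_limit_def
proof (rule tendstoI)
  fix e :: real assume e: "e > 0"
  obtain d where d: "d > 0" "\<And>y. dist y x < d \<Longrightarrow> dist (u y) (u x) < e / 2"
    using assms e unfolding continuous_at_eps_delta by (metis half_gt_zero)
  show "\<forall>\<^sub>F r in at_right 0. dist ((LINT y:ball x r|lebesgue. norm (u y - u x)) / measure lebesgue (ball x r)) 0 < e"
    unfolding eventually_at_right_field
  proof (intro exI[of _ d] conjI allI impI)
    fix r :: real assume r: "0 < r" "r < d"
    have "norm (u y - u x) \<le> e / 2" if "y \<in> ball x r" for y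
      using d(2)[of y] that r by (simp add: dist_norm norm_minus_commute)
    then have "(LINT y:ball x r|lebesgue. norm (u y - u x)) / measure lebesgue (ball x r) \<le> e / 2"
      using r e by (intro ball_average_upper_bound) auto
    moreover have "0 \<le> (LINT y:ball x r|lebesgue. norm (u y - u x)) / measure lebesgue (ball x r)"
      by (auto simp: set_lebesgue_integral_def intro!: divide_nonneg_nonneg integral_nonneg)
    ultimately show "dist ((LINT y:ball x r|lebesgue. norm (u y - u x)) / measure lebesgue (ball x r)) 0 < e"
      using e unfolding dist_real_def by linarith
  qed (use d in auto)
qed

lemma has_derivative_has_approx_derivative:
  fixes u :: "real^'n \<Rightarrow> real^'m"
  assumes A: "(u has_derivative (\<lambda>h. A *v h)) (at x)"
  shows "has_approx_derivative u A x"
  unfolding has_approx_derivative_def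
proof (intro exI conjI)
  show "has_approx_limit u (u x) x"
    using A by (intro isCont_has_approx_limit has_derivative_continuous)
  let ?avg = "\<lambda>r. (LINT y:ball x r|lebesgue. norm (u y - u x - A *v (y - x)) / r) / measure lebesgue (ball x r)"
  show "(?avg \<longlongrightarrow> 0) (at_right 0)"
  proof (rule tendstoI)
    fix e :: real assume e: "e > 0"
    obtain d where d: "d > 0" "\<And>y. norm (y - x) < d \<Longrightarrow> norm (u y - u x - A *v (y - x)) \<le> e / 2 * norm (y - x)"
      using A e unfolding has_derivative_at_alt by (metis half_gt_zero)
    show "\<forall>\<^sub>F r in at_right 0. dist (?avg r) 0 < e"
      unfolding eventually_at_right_field
    proof (intro exI[of _ d] conjI allI impI)
      fix r :: real assume r: "0 < r" "r < d"
      have "norm (u y - u x - A *v (y - x)) / r \<le> e / 2" if "y \<in> ball x r" for y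
      proof -
        have yr: "norm (y - x) < r"
          using that by (simp add: dist_norm norm_minus_commute)
        then have "norm (u y - u x - A *v (y - x)) \<le> e / 2 * norm (y - x)"
          using d(2)[of y] r by simp
        also have "\<dots> \<le> e / 2 * r"
          using yr e by simp
        finally show ?thesis
          using r by (simp add: field_simps)
      qed
      then have "?avg r \<le> e / 2"
        using r e by (intro ball_average_upper_bound) auto
      moreover have "0 \<le> ?avg r"
        using r by (auto simp: set_lebesgue_integral_def intro!: divide_nonneg_nonneg integral_nonneg)
      ultimately show "dist (?avg r) 0 < e"
        using e unfolding dist_real_def by linarith
    qed (use d in auto)
  qed
qed

section \<open>Maps depending only on z\<close>

lemma power2_norm_matrix3:
  fixes A :: "real^3^3"
  shows "(norm A)\<^sup>2 = (A$1$1)\<^sup>2 + (A$1$2)\<^sup>2 + (A$1$3)\<^sup>2 + (A$2$1)\<^sup>2 + (A$2$2)\<^sup>2 + (A$2$3)\<^sup>2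
    + (A$3$1)\<^sup>2 + (A$3$2)\<^sup>2 + (A$3$3)\<^sup>2"
  unfolding power2_norm_eq_inner inner_vec_def sum_3 by (simp add: power2_eq_square)

lemma power2_norm_vec3:
  fixes v :: "real^3"
  shows "(norm v)\<^sup>2 = (v$1)\<^sup>2 + (v$2)\<^sup>2 + (v$3)\<^sup>2"
  unfolding power2_norm_eq_inner inner_vec_def sum_3 by (simp add: power2_eq_square)

lemma inner_curl_of_gradient:
  "v \<bullet> curl_of_gradient A = v$1 * (A$3$2 - A$2$3) + v$2 * (A$1$3 - A$3$1) + v$3 * (A$2$1 - A$1$2)"
  by (simp add: curl_of_gradient_def inner_vec_def sum_3)

lemma Omega_eq_box: "Omega L1 L2 d = box (vector [-L1, -L2, 0]) (vector [L1, L2, d])"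
  by (auto simp: Omega_def mem_box_cart forall_3)

lemma open_Omega: "open (Omega L1 L2 d)"
  unfolding Omega_eq_box by (rule open_box)

lemma bounded_Omega: "bounded (Omega L1 L2 d)"
  unfolding Omega_eq_box by (rule bounded_box)

text \<open>Horizontal translations preserve \<open>m\<close>, which annihilates the first two
  columns of any approximate derivative. Where there is none, the gradient is 0 by
  convention.\<close>

lemma approx_gradient_depends_only_on_z:
  assumes m: "depends_only_on_z L1 L2 d m" and int: "m absolutely_integrable_on Omega L1 L2 d"
    and x: "x \<in> Omega L1 L2 d" and j: "j \<noteq> 3"
  shows "approx_gradient m x $ i $ j = 0"
proof (cases "\<exists>A. has_approx_derivative m A x")
  case False
  then show ?thesis by (simp add: approx_gradient_def)
next
  case True
  then obtain A where A: "has_approx_derivative m A x" by blast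
  note int' = eventually_absolutely_integrable_ball[OF int open_Omega x]
  obtain f where f: "AE p in lebesgue. p \<in> Omega L1 L2 d \<longrightarrow> m p = f (p $ 3)"
    using m open_Omega unfolding depends_only_on_z_def
    by (auto simp: AE_restrict_space_iff borel_open)
  obtain e where e: "e > 0" "ball x e \<subseteq> Omega L1 L2 d"
    using open_Omega x openE by blast
  have "A *v axis j 1 = 0"
  proof (rule has_approx_derivative_invariant_direction[OF A int'])
    show "norm (axis j 1 :: real^3) = 1" by simp
    show "\<forall>\<^sub>F r in at_right 0. AE y in lebesgue. y \<in> ball x (r / 2) \<longrightarrow> m (y + (r / 2) *\<^sub>R axis j 1) = m y"
      unfolding eventually_at_right_field
    proof (intro exI[of _ e] conjI allI impI)
      fix r :: real assume r: "0 < r" "r < e"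
      \<comment> \<open>Since \<open>m p = f (p $ 3)\<close> holds only almost everywhere, it is
        needed both at \<open>y\<close> and at the translate of \<open>y\<close>; the exceptional
        set and its translate are both null.\<close>
      show "AE y in lebesgue. y \<in> ball x (r / 2) \<longrightarrow> m (y + (r / 2) *\<^sub>R axis j 1) = m y"
        using f AE_lebesgue_plus[OF f, of "(r / 2) *\<^sub>R axis j 1"]
      proof eventually_elim
        case (elim y)
        show ?case
        proof
          assume y: "y \<in> ball x (r / 2)"
          have "dist x (y + (r / 2) *\<^sub>R axis j 1) \<le> dist x y + norm ((r / 2) *\<^sub>R (axis j 1 :: real^3))"
            using norm_triangle_ineq4[of "x - y" "(r / 2) *\<^sub>R (axis j 1 :: real^3)"]
            by (simp add: dist_norm algebra_simps)
          then have "y + (r / 2) *\<^sub>R axis j 1 \<in> ball x e" "y \<in> ball x e"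
            using y r by auto
          moreover have "(y + (r / 2) *\<^sub>R axis j 1) $ 3 = y $ 3"
            using j by (simp add: axis_def)
          ultimately show "m (y + (r / 2) *\<^sub>R axis j 1) = m y"
            using elim e(2) by (metis subsetD)
        qed
      qed
    qed (use e in auto)
  qed
  then have "A $ i $ j = 0"
    by (simp add: matrix_vector_mult_basis column_def vec_eq_iff)
  then show ?thesis
    by (simp add: approx_gradient_eqI[OF A int'])
qed

text \<open>Pointwise nonnegativity of the density suffices, since a Bochner integral of a
  nonnegative function is nonnegative even when integrability fails.\<close>

lemma energy_nonneg_depends_only_on_z:
  assumes m: "depends_only_on_z L1 L2 d m" and int: "m absolutely_integrable_on Omega L1 L2 d" and K: "K > 0"
  shows "energy L1 L2 d \<epsilon> K t m \<ge> 0"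
proof -
  have "(norm (approx_gradient m p))\<^sup>2 + 2 * t * (m p \<bullet> curl_of_gradient (approx_gradient m p)) + t\<^sup>2 * (norm (m p))\<^sup>2 \<ge> 0"
    if p: "p \<in> Omega L1 L2 d" for p
  proof -
    let ?A = "approx_gradient m p"
    have z: "?A $ i $ 1 = 0" "?A $ i $ 2 = 0" for i
      using approx_gradient_depends_only_on_z[OF m int p] by simp_all
    have "(norm ?A)\<^sup>2 + 2 * t * (m p \<bullet> curl_of_gradient ?A) + t\<^sup>2 * (norm (m p))\<^sup>2
      = (?A$1$3 + t * m p $ 2)\<^sup>2 + (?A$2$3 - t * m p $ 1)\<^sup>2 + (?A$3$3)\<^sup>2 + (t * m p $ 3)\<^sup>2"
      by (simp add: power2_norm_matrix3 power2_norm_vec3 inner_curl_of_gradient z)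
         (simp add: power2_eq_square algebra_simps)
    then show ?thesis by simp
  qed
  then show ?thesis
    using K unfolding energy_def set_lebesgue_integral_def
    by (intro add_nonneg_nonneg integral_nonneg) (auto simp: indicator_def)
qed

section \<open>Hausdorff measure of plane pieces\<close>

text \<open>Each square is cut into a grid whose images under the 1-Lipschitz maps form the cover.
  The constant \<open>16 * pi * R\<^sup>2\<close> is crude: only proportionality to the number of
  pieces matters for the energy estimate.\<close>

lemma hausdorff_measure_2_le:
  fixes f :: "'i \<Rightarrow> real \<times> real \<Rightarrow> 'a::real_normed_vector"
  assumes I: "finite I" and R: "R > 0"
    and lip: "\<And>i p q. i \<in> I \<Longrightarrow> dist (f i p) (f i q) \<le> dist p q"
    and S: "S \<subseteq> (\<Union>i\<in>I. f i ` ({-R..R} \<times> {-R..R}))"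
  shows "hausdorff_measure 2 S \<le> ennreal (real (card I) * (16 * pi * R\<^sup>2))"
  unfolding hausdorff_measure_def
proof (rule SUP_least)
  fix \<delta> :: real assume "\<delta> \<in> {0<..}"
  \<comment> \<open>The grid is fine enough that the cell diameters, at most
    \<open>4 * R / n0\<close>, are strictly below \<open>\<delta>\<close>.\<close>
  then obtain n0 :: nat where n0: "4 * R / \<delta> < real n0"
    using reals_Archimedean2 by blast
  have "0 < 4 * R / \<delta>" using R \<open>\<delta> \<in> {0<..}\<close> by simp
  then have n: "n0 > 0" using n0 by linarith
  let ?c = "\<lambda>a::nat. {- R + 2 * R * a / n0 .. - R + 2 * R * (a + 1) / n0}"
  \<comment> \<open>The index \<open>n0\<close> is included because the endpoint \<open>R\<close>
    has floor exactly \<open>n0\<close>. This gives \<open>(n0 + 1) ^ 2\<close> cells, and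
    \<open>(n0 + 1) / n0 \<le> 2\<close> costs a factor 4 below.\<close>
  define T where "T = I \<times> {..n0} \<times> {..n0}"
  define F where "F = (\<lambda>(i, a, b). f i ` (?c a \<times> ?c b))"
  have T: "finite T" "card T = card I * (n0 + 1) ^ 2"
    using I by (auto simp: T_def power2_eq_square)
  have FT: "dist y y' \<le> 4 * R / n0" if tau: "\<tau> \<in> T" and y: "y \<in> F \<tau>" "y' \<in> F \<tau>" for \<tau> y y'
  proof -
    obtain i a b where \<tau>: "\<tau> = (i, a, b)" "i \<in> I"
      using tau by (auto simp: T_def)
    obtain p q where p: "y = f i p" "p \<in> ?c a \<times> ?c b" and q: "y' = f i q" "q \<in> ?c a \<times> ?c b"
      using y by (auto simp: F_def \<tau>)
    have "dist y y' \<le> dist p q" using lip \<tau> p q by simp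
    also have "\<dots> \<le> \<bar>fst p - fst q\<bar> + \<bar>snd p - snd q\<bar>"
      by (simp add: dist_prod_def dist_real_def sqrt_sum_squares_le_sum_abs)
    also have "\<dots> \<le> 2 * R / n0 + 2 * R / n0"
    proof -
      have "\<bar>u - v\<bar> \<le> 2 * R / n0" if "u \<in> ?c a" "v \<in> ?c a" for u v a
        using that by (auto simp: algebra_simps add_divide_distrib abs_le_iff)
      then show ?thesis using p q by (intro add_mono) (auto simp: mem_Times_iff)
    qed
    finally show ?thesis by simp
  qed
  have cover: "S \<subseteq> (\<Union>\<tau>\<in>T. F \<tau>)"
  proof
    fix s assume "s \<in> S"
    then obtain i u v where s: "i \<in> I" "s = f i (u, v)" "u \<in> {-R..R}" "v \<in> {-R..R}"
      using S by blast
    have *: "nat \<lfloor>(w + R) * n0 / (2 * R)\<rfloor> \<le> n0 \<and> w \<in> ?c (nat \<lfloor>(w + R) * n0 / (2 * R)\<rfloor>)" if "w \<in> {-R..R}" for w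
    proof -
      let ?k = "\<lfloor>(w + R) * n0 / (2 * R)\<rfloor>"
      have k0: "0 \<le> ?k" using that R by simp
      have "(w + R) * n0 / (2 * R) \<le> n0"
        using that R by (simp add: field_simps mult_right_mono)
      then have "?k \<le> n0" by linarith
      moreover have k: "real_of_int ?k \<le> (w + R) * n0 / (2 * R)" "(w + R) * n0 / (2 * R) \<le> real_of_int ?k + 1"
        by linarith+
      have "2 * R * real_of_int ?k / n0 \<le> w + R" "w + R \<le> 2 * R * (real_of_int ?k + 1) / n0"
      proof -
        have X: "2 * R * ((w + R) * n0 / (2 * R)) / n0 = w + R"
          using R n by simp
        have "2 * R * real_of_int ?k / n0 \<le> 2 * R * ((w + R) * n0 / (2 * R)) / n0"
          "2 * R * ((w + R) * n0 / (2 * R)) / n0 \<le> 2 * R * (real_of_int ?k + 1) / n0"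
          using R by (intro divide_right_mono mult_left_mono k; simp)+
        then show "2 * R * real_of_int ?k / n0 \<le> w + R" "w + R \<le> 2 * R * (real_of_int ?k + 1) / n0"
          unfolding X .
      qed
      ultimately show ?thesis using k0 by (simp add: of_nat_nat)
    qed
    show "s \<in> (\<Union>\<tau>\<in>T. F \<tau>)"
    proof (rule UN_I)
      show "(i, nat \<lfloor>(u + R) * n0 / (2 * R)\<rfloor>, nat \<lfloor>(v + R) * n0 / (2 * R)\<rfloor>) \<in> T"
        using s *[of u] *[of v] by (simp add: T_def)
      show "s \<in> F (i, nat \<lfloor>(u + R) * n0 / (2 * R)\<rfloor>, nat \<lfloor>(v + R) * n0 / (2 * R)\<rfloor>)"
        unfolding F_def prod.case s(2) using *[OF s(3)] *[OF s(4)] by (intro imageI) (simp only: mem_Times_iff fst_conv snd_conv)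
    qed
  qed
  obtain h where h: "bij_betw h {0..<card T} T"
    using ex_bij_betw_nat_finite[OF T(1)] by blast
  \<comment> \<open>A cover must be an infinite sequence; the padding sets are empty and cost
    0.\<close>
  define C where "C k = (if k < card T then F (h k) else {})" for k
  have C: "dist y y' \<le> 4 * R / n0" if "y \<in> C k" "y' \<in> C k" for k y y'
    using that FT[of "h k"] bij_betwE[OF h] by (auto simp: C_def split: if_splits)
  have dC: "diameter (C k) \<le> 4 * R / n0" for k
    using C[of _ k] R by (intro diameter_le) (auto simp: dist_norm)
  have "4 * R / n0 < \<delta>"
    using n0 \<open>\<delta> \<in> {0<..}\<close> n by (simp add: field_simps)
  moreover have "bounded (C k)" for k
  proof (cases "C k = {}")
    case False
    then obtain y where "y \<in> C k" by blast
    then show ?thesis using C[of y k] unfolding bounded_def by blast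
  qed simp
  moreover have "S \<subseteq> (\<Union>k. C k)"
  proof
    fix s assume "s \<in> S"
    then obtain \<tau> where \<tau>: "\<tau> \<in> T" "s \<in> F \<tau>" using cover by blast
    then obtain k where "k < card T" "h k = \<tau>"
      using h unfolding bij_betw_def by (metis atLeastLessThan_iff imageE)
    then show "s \<in> (\<Union>k. C k)" using \<tau> by (auto simp: C_def)
  qed
  ultimately have "hausdorff_pre 2 \<delta> S \<le> (\<Sum>k. if C k = {} then 0
             else ennreal (unit_ball_vol (real 2) * (diameter (C k) / 2) ^ 2))"
    unfolding hausdorff_pre_def using dC by (intro INF_lower) (auto intro: le_less_trans)
  also have "\<dots> = (\<Sum>k\<in>{..<card T}. if C k = {} then 0
             else ennreal (unit_ball_vol (real 2) * (diameter (C k) / 2) ^ 2))"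
    by (rule suminf_finite) (auto simp: C_def)
  also have "\<dots> \<le> (\<Sum>k\<in>{..<card T}. ennreal (pi * (2 * R / n0)\<^sup>2))"
  proof (rule sum_mono)
    fix k
    have "(diameter (C k) / 2)\<^sup>2 \<le> (2 * R / n0)\<^sup>2"
      using dC[of k] by (intro power_mono) (auto simp: diameter_ge_0 \<open>bounded (C k)\<close>)
    then show "(if C k = {} then 0 else ennreal (unit_ball_vol (real 2) * (diameter (C k) / 2) ^ 2))
      \<le> ennreal (pi * (2 * R / n0)\<^sup>2)"
      by (auto simp: unit_ball_vol_2 intro!: ennreal_leI mult_left_mono)
  qed
  also have "\<dots> = ennreal (real (card T) * (pi * (2 * R / n0)\<^sup>2))"
    by (simp add: ennreal_of_nat_eq_real_of_nat ennreal_mult)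
  also have "\<dots> \<le> ennreal (real (card I) * (16 * pi * R\<^sup>2))"
  proof (rule ennreal_leI)
    have "real (n0 + 1) / n0 \<le> 2" using n by (simp add: field_simps)
    then have "(real (n0 + 1) / n0)\<^sup>2 \<le> 2\<^sup>2" by (intro power_mono) auto
    then have "real (card I) * (4 * pi * R\<^sup>2) * (real (n0 + 1) / n0)\<^sup>2 \<le> real (card I) * (4 * pi * R\<^sup>2) * 2\<^sup>2"
      by (intro mult_left_mono) auto
    then show "real (card T) * (pi * (2 * R / n0)\<^sup>2) \<le> real (card I) * (16 * pi * R\<^sup>2)"
      by (simp add: T(2) power_divide power_mult_distrib mult_ac)
  qed
  finally show "hausdorff_pre 2 \<delta> S \<le> ennreal (real (card I) * (16 * pi * R\<^sup>2))" .
qed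

section \<open>Integration over planes\<close>

text \<open>The point with \<open>j\<close>-th coordinate \<open>s\<close> whose remaining coordinates are, in order, those of \<open>q\<close>.\<close>

definition slot :: "3 \<Rightarrow> real \<Rightarrow> real \<times> real \<Rightarrow> real^3" where
  "slot j s q = s *\<^sub>R axis j 1 + fst q *\<^sub>R axis (if j = 1 then 2 else 1) 1 + snd q *\<^sub>R axis (if j = 3 then 2 else 3) 1"

lemma slot_nth:
  "slot 1 s q $ 1 = s" "slot 1 s q $ 2 = fst q" "slot 1 s q $ 3 = snd q"
  "slot 2 s q $ 1 = fst q" "slot 2 s q $ 2 = s" "slot 2 s q $ 3 = snd q"
  "slot 3 s q $ 1 = fst q" "slot 3 s q $ 2 = snd q" "slot 3 s q $ 3 = s"
  by (simp_all add: slot_def axis_def)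

lemma slot_nth_same: "slot j s q $ j = s"
  using exhaust_3[of j] by (auto simp: slot_nth)

lemma slot_surj: "\<exists>q. p = slot j (p $ j) q"
proof -
  have "p = slot j (p $ j) (p $ (if j = 1 then 2 else 1), p $ (if j = 3 then 2 else 3))"
    using exhaust_3[of j] by (auto simp: vec_eq_iff forall_3 slot_nth)
  then show ?thesis by blast
qed

lemma dist_slot: "dist (slot j s p) (slot j s q) = dist p q"
  using exhaust_3[of j]
  by (auto simp: dist_vec_def L2_set_def sum_3 slot_nth dist_prod_def add_ac)

lemma continuous_on_slot: "continuous_on UNIV (\<lambda>(s, q). slot j s q)"
  unfolding slot_def case_prod_unfold by (intro continuous_intros)

lemma measurable_slot [measurable]:
  assumes [measurable]: "f \<in> borel_measurable M" "g \<in> borel_measurable M"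
  shows "(\<lambda>x. slot j (f x) (g x)) \<in> borel_measurable M"
  using borel_measurable_continuous_Pair[where H = "slot j", OF assms] continuous_on_slot[of j]
  by (simp add: case_prod_unfold)

lemma borel_measurable_vec_nth [measurable (raw)]:
  fixes f :: "'a \<Rightarrow> 'b::euclidean_space ^ 'n"
  assumes "f \<in> borel_measurable M"
  shows "(\<lambda>x. f x $ i) \<in> borel_measurable M"
  by (rule borel_measurable_continuous_on[OF _ assms]) (intro continuous_intros)

lemma emeasure_lborel_Times:
  fixes A :: "'a::euclidean_space set" and B :: "'b::euclidean_space set"
  assumes "A \<in> sets borel" "B \<in> sets borel"
  shows "emeasure lborel (A \<times> B) = emeasure lborel A * emeasure lborel B"
  unfolding lborel_prod[symmetric] using assms by (intro lborel.emeasure_pair_measure_Times) auto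

lemma prod_Basis_vec: "(\<Prod>b\<in>(Basis :: (real^'n) set). f b) = (\<Prod>i\<in>UNIV. f (axis i 1))"
proof -
  have eq: "(Basis :: (real^'n) set) = (\<lambda>i. axis i 1) ` UNIV"
    by (auto simp: Basis_vec_def)
  show ?thesis
    unfolding eq by (subst prod.reindex) (auto simp: inj_on_def axis_eq_axis)
qed

text \<open>Up to the product structure this is a permutation of coordinates, and agreement on boxes
  determines Lebesgue measure.\<close>

lemma lborel_slot: "distr lborel borel (\<lambda>(s, q). slot j s q) = lborel"
proof (rule lborel_eqI[symmetric])
  fix l u :: "real^3" assume lu: "\<And>b. b \<in> Basis \<Longrightarrow> l \<bullet> b \<le> u \<bullet> b"
  have le: "l $ i \<le> u $ i" for i
    using lu[of "axis i 1"] by (auto simp: axis_in_Basis_iff inner_axis)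
  have em: "emeasure lborel (box (l $ i) (u $ i)) = ennreal (u $ i - l $ i)" for i
    using le[of i] by simp
  define a b :: 3 where ab: "a = (if j = 1 then 2 else 1)" "b = (if j = 3 then 2 else 3)"
  have m: "(\<lambda>(s, q). slot j s q) \<in> borel_measurable lborel"
    using borel_measurable_continuous_onI[OF continuous_on_slot[of j]] by simp
  have vi: "(\<lambda>(s, q). slot j s q) -` box l u \<inter> space lborel
      = box (l $ j) (u $ j) \<times> (box (l $ a) (u $ a) \<times> box (l $ b) (u $ b))"
    using exhaust_3[of j] by (auto simp: mem_box_cart forall_3 slot_nth ab)
  have "emeasure (distr lborel borel (\<lambda>(s, q). slot j s q)) (box l u)
      = emeasure lborel (box (l $ j) (u $ j) \<times> (box (l $ a) (u $ a) \<times> box (l $ b) (u $ b)))"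
    by (simp only: emeasure_distr[OF m borel_open[OF open_box]] vi)
  also have "\<dots> = emeasure lborel (box (l $ j) (u $ j)) * (emeasure lborel (box (l $ a) (u $ a)) * emeasure lborel (box (l $ b) (u $ b)))"
    by (simp only: emeasure_lborel_Times borel_open open_Times open_box)
  also have "\<dots> = ennreal ((u $ j - l $ j) * ((u $ a - l $ a) * (u $ b - l $ b)))"
    unfolding em by (simp add: ennreal_mult le)
  also have "(u $ j - l $ j) * ((u $ a - l $ a) * (u $ b - l $ b)) = (\<Prod>b\<in>Basis. (u - l) \<bullet> b)"
  proof -
    have eq: "(\<Prod>b\<in>Basis. (u - l) \<bullet> b) = (u $ 1 - l $ 1) * (u $ 2 - l $ 2) * (u $ 3 - l $ 3)"
      unfolding prod_Basis_vec UNIV_3 by (simp add: inner_axis)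
    consider "j = 1" | "j = 2" | "j = 3" using exhaust_3[of j] by blast
    then show ?thesis
      unfolding eq by cases (simp_all add: ab)
  qed
  finally show "emeasure (distr lborel borel (\<lambda>(s, q). slot j s q)) (box l u) = (\<Prod>b\<in>Basis. (u - l) \<bullet> b)" .
qed simp

text \<open>The inner integral runs along the line in direction \<open>j\<close>, the order in which
  a derivative in that direction can be integrated by parts.\<close>

lemma integral_slot:
  fixes f :: "real^3 \<Rightarrow> real"
  assumes f: "integrable lborel f"
  shows "(LINT p|lborel. f p) = (LINT q|lborel. LINT s|lborel. f (slot j s q))"
proof -
  have m: "(\<lambda>(s, q). slot j s q) \<in> lborel \<rightarrow>\<^sub>M borel"
    using borel_measurable_continuous_onI[OF continuous_on_slot[of j]] by simp
  have fm: "f \<in> borel_measurable borel"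
    using f by (auto dest: borel_measurable_integrable)
  have "integrable (distr lborel borel (\<lambda>(s, q). slot j s q)) f"
    using f by (simp add: lborel_slot)
  then have int: "integrable (lborel \<Otimes>\<^sub>M lborel) (\<lambda>(s, q). f (slot j s q))"
    using integrable_distr_eq[OF m fm] by (simp add: lborel_prod case_prod_unfold)
  have "(LINT p|lborel. f p) = (LINT x|lborel. f (case x of (s, q) \<Rightarrow> slot j s q))"
    by (subst lborel_slot[of j, symmetric]) (rule integral_distr[OF m fm])
  also have "\<dots> = (\<integral>x. (\<lambda>(s, q). f (slot j s q)) x \<partial>(lborel \<Otimes>\<^sub>M lborel))"
    by (simp add: lborel_prod case_prod_unfold)
  also have "\<dots> = (LINT q|lborel. LINT s|lborel. f (slot j s q))"
    by (rule lborel_pair.integral_snd[OF int, symmetric])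
  finally show ?thesis .
qed

lemma integrable_lborel_bounded:
  fixes f :: "'a::euclidean_space \<Rightarrow> 'b::euclidean_space"
  assumes f: "f \<in> borel_measurable borel" and B: "\<And>x. norm (f x) \<le> B"
    and A: "bounded A" "\<And>x. x \<notin> A \<Longrightarrow> f x = 0"
  shows "integrable lborel f"
proof -
  obtain a where a: "A \<subseteq> cbox (-a) a"
    using bounded_subset_cbox_symmetric[OF A(1)] by blast
  have "integrable lborel (\<lambda>x. indicator (cbox (-a) a) x *\<^sub>R B)"
    using emeasure_bounded_finite[OF bounded_cbox, of "-a" a]
    by (intro integrable_scaleR_left integrable_real_indicator) auto
  then show ?thesis
  proof (rule Bochner_Integration.integrable_bound)
    have "norm (f x) \<le> norm (indicator (cbox (-a) a) x *\<^sub>R B)" for x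
      using B[of x] A(2)[of x] a by (cases "x \<in> A") (auto simp: indicator_def)
    then show "AE x in lborel. norm (f x) \<le> norm (indicator (cbox (-a) a) x *\<^sub>R B)"
      by simp
  qed (use f in simp)
qed

text \<open>The sum, over the planes \<open>{p. p $ k = s}\<close> with \<open>(k, s) \<in> I\<close>, of their area measures.\<close>

definition planes_measure :: "(3 \<times> real) set \<Rightarrow> (real^3) measure" where
  "planes_measure I = distr (count_space I \<Otimes>\<^sub>M lborel) borel (\<lambda>((k, s), q). slot k s q)"

lemma measurable_planes:
  assumes "finite I"
  shows "(\<lambda>((k, s), q). slot k s q) \<in> count_space I \<Otimes>\<^sub>M lborel \<rightarrow>\<^sub>M borel"
  by (rule measurable_pair_measure_countable1) (use assms in \<open>auto simp: countable_finite\<close>)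

lemma integrable_slot:
  fixes f :: "real^3 \<Rightarrow> real"
  assumes f: "f \<in> borel_measurable borel" and B: "\<And>x. norm (f x) \<le> B"
    and A: "bounded A" "\<And>x. x \<notin> A \<Longrightarrow> f x = 0"
  shows "integrable lborel (\<lambda>q. f (slot k s q))"
proof (rule integrable_lborel_bounded)
  show "(\<lambda>q. f (slot k s q)) \<in> borel_measurable borel"
    using f by measurable
  obtain R where R: "\<And>x. x \<in> A \<Longrightarrow> norm x \<le> R"
    using A(1) unfolding bounded_iff by blast
  show "bounded {q. slot k s q \<in> A}"
  proof (rule boundedI)
    fix q assume "q \<in> {q. slot k s q \<in> A}"
    then have "norm (slot k s q) \<le> R" using R by simp
    moreover have "norm q = dist (slot k s q) (slot k s 0)"
      by (simp add: dist_slot)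
    ultimately show "norm q \<le> R + norm (slot k s 0)"
      by (smt (verit) dist_norm norm_triangle_ineq4)
  qed
qed (use A(2) B in auto)

lemma
  fixes f :: "real^3 \<Rightarrow> real"
  assumes I: "finite I" and f: "f \<in> borel_measurable borel" and B: "\<And>x. norm (f x) \<le> B"
    and A: "bounded A" "\<And>x. x \<notin> A \<Longrightarrow> f x = 0"
  shows integrable_planes_measure: "integrable (planes_measure I) f"
    and integral_planes_measure: "(LINT p|planes_measure I. f p) = (\<Sum>(k, s)\<in>I. LINT q|lborel. f (slot k s q))"
proof -
  let ?F = "\<lambda>x. f ((\<lambda>((k, s), q). slot k s q) x)"
  interpret I: sigma_finite_measure "count_space I"
    using I by (rule sigma_finite_measure_count_space_finite)
  interpret P: pair_sigma_finite "count_space I" "lborel :: (real \<times> real) measure" ..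
  note m = measurable_planes[OF I]
  note intq = integrable_slot[OF f B A]
  have int: "integrable (count_space I \<Otimes>\<^sub>M lborel) ?F"
  proof (rule P.Fubini_integrable)
    show "?F \<in> borel_measurable (count_space I \<Otimes>\<^sub>M lborel)"
      by (rule measurable_compose[OF m f])
    show "integrable (count_space I) (\<lambda>x. LINT y|lborel. norm (?F (x, y)))"
      using I by (rule integrable_count_space)
    show "AE x in count_space I. integrable lborel (\<lambda>y. ?F (x, y))"
      using intq by (auto simp: case_prod_unfold)
  qed
  show "integrable (planes_measure I) f"
    unfolding planes_measure_def using integrable_distr_eq[OF m f] int by simp
  have "(LINT p|planes_measure I. f p) = (\<integral>x. ?F x \<partial>(count_space I \<Otimes>\<^sub>M lborel))"
    unfolding planes_measure_def by (rule integral_distr[OF m f])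
  also have "\<dots> = (LINT x|count_space I. LINT y|lborel. ?F (x, y))"
    by (rule P.integral_fst'[OF int, symmetric])
  also have "\<dots> = (\<Sum>x\<in>I. LINT y|lborel. ?F (x, y))"
    using I by (rule lebesgue_integral_count_space_finite)
  finally show "(LINT p|planes_measure I. f p) = (\<Sum>(k, s)\<in>I. LINT q|lborel. f (slot k s q))"
    by (simp add: case_prod_unfold)
qed

text \<open>For a Lebesgue null set \<open>N\<close> this says that the plane measure is singular,
  as the decomposition of the derivative demands.\<close>

lemma emeasure_planes_measure_Compl:
  assumes I: "finite I" and N: "N \<in> sets borel" "\<And>k s q. (k, s) \<in> I \<Longrightarrow> slot k s q \<in> N"
  shows "emeasure (planes_measure I) (- N) = 0"
proof -
  have "(\<lambda>((k, s), q). slot k s q) -` (- N) \<inter> space (count_space I \<Otimes>\<^sub>M lborel) = {}"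
    using N(2) by (auto simp: space_pair_measure)
  then show ?thesis
    unfolding planes_measure_def using N(1) by (subst emeasure_distr[OF measurable_planes[OF I]]) auto
qed

text \<open>Serves to discard, inside a plane, the lines along which it meets planes of other
  directions.\<close>

lemma AE_lborel_pair_notin_countable:
  fixes K :: "real set"
  assumes K: "countable K"
  shows "AE q in lborel. fst (q :: real \<times> real) \<notin> K \<and> snd q \<notin> K"
proof -
  have Kn: "K \<in> null_sets lborel" using K by (rule countable_imp_null_set_lborel)
  have "K \<times> (UNIV :: real set) \<in> null_sets (lborel \<Otimes>\<^sub>M lborel)" "(UNIV :: real set) \<times> K \<in> null_sets (lborel \<Otimes>\<^sub>M lborel)"
    by (intro lborel.times_in_null_sets1 lborel.times_in_null_sets2 Kn; simp)+
  then have "K \<times> UNIV \<union> UNIV \<times> K \<in> null_sets (lborel :: (real \<times> real) measure)"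
    unfolding lborel_prod by (rule null_sets.Un)
  then show ?thesis
    by (rule AE_I') auto
qed

section \<open>Integration by parts with jumps\<close>

text \<open>A jump of \<open>f\<close> at \<open>u\<close> is carried by the continuous function \<open>\<phi> (max s u) - \<phi> u\<close>.\<close>

lemma has_integral_by_parts_jumps:
  fixes f fc D \<phi> \<phi>' c :: "real \<Rightarrow> real"
  assumes ab: "a \<le> b" and S: "finite S" and T: "finite T"
    and fc: "continuous_on {a..b} fc" "\<And>s. s \<in> {a<..<b} - T \<Longrightarrow> (fc has_real_derivative D s) (at s)"
    and \<phi>: "\<And>s. (\<phi> has_real_derivative \<phi>' s) (at s)" "\<And>s. s \<notin> {a<..<b} \<Longrightarrow> \<phi> s = 0"
    and f: "\<And>s. s \<in> {a..b} - T \<Longrightarrow> f s = fc s + (\<Sum>u\<in>S. c u * of_bool (u \<le> s))"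
  shows "((\<lambda>s. f s * \<phi>' s + \<phi> s * D s) has_integral - (\<Sum>u\<in>S. c u * \<phi> u)) {a..b}"
proof -
  define h where "h s = fc s * \<phi> s + (\<Sum>u\<in>S. c u * (\<phi> (max s u) - \<phi> u))" for s
  define h' where "h' s = D s * \<phi> s + \<phi>' s * fc s + (\<Sum>u\<in>S. c u * (\<phi>' s * of_bool (u \<le> s)))" for s
  have cont\<phi>: "continuous_on X \<phi>" for X
    using \<phi>(1) by (meson DERIV_isCont continuous_at_imp_continuous_on)
  have "(h' has_integral (h b - h a)) {a..b}"
  proof (rule fundamental_theorem_of_calculus_interior_strong[of "S \<union> T"])
    show "continuous_on {a..b} h"
      unfolding h_def by (intro continuous_intros fc cont\<phi> continuous_on_compose2[OF cont\<phi>[of UNIV]]) auto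
    show "(h has_vector_derivative h' x) (at x)" if x: "x \<in> {a<..<b} - (S \<union> T)" for x
    proof -
      have "((\<lambda>s. \<phi> (max s u) - \<phi> u) has_real_derivative \<phi>' x * of_bool (u \<le> x)) (at x)" if "u \<in> S" for u
      proof (cases "u < x")
        case True
        have "((\<lambda>s. \<phi> s - \<phi> u) has_real_derivative \<phi>' x) (at x)"
          using \<phi>(1)[of x] by (auto intro!: derivative_eq_intros)
        then show ?thesis
          using True by (subst has_field_derivative_cong_eventually[where g = "\<lambda>s. \<phi> s - \<phi> u"])
            (auto simp: eventually_at_topological max_def intro!: exI[of _ "{u<..}"])
      next
        case False
        then have "x < u" using x that by (cases "x = u") auto
        then show ?thesis
          by (subst has_field_derivative_cong_eventually[where g = "\<lambda>s. 0"])
            (auto simp: eventually_at_topological max_def intro!: exI[of _ "{..<u}"])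
      qed
      then have "(h has_real_derivative h' x) (at x)"
        unfolding h_def h'_def using x fc(2)[of x] \<phi>(1)[of x]
        by (intro DERIV_add DERIV_mult DERIV_sum DERIV_cmult) auto
      then show ?thesis
        by (simp add: has_real_derivative_iff_has_vector_derivative)
    qed
  qed (use S T ab in auto)
  \<comment> \<open>\<open>\<phi>\<close> vanishes outside the open interval, so jump points of
    \<open>S\<close> lying outside it contribute nothing. This matters because \<open>S\<close> will
    be a set of kinks that overshoots the interval.\<close>
  moreover have "\<phi> (max a u) - \<phi> u = 0" for u
    using \<phi>(2)[of a] \<phi>(2)[of u] by (auto simp: max_def)
  moreover have "\<phi> (max b u) - \<phi> u = - \<phi> u" for u
    using \<phi>(2)[of b] \<phi>(2)[of u] by (auto simp: max_def)
  ultimately have "(h' has_integral - (\<Sum>u\<in>S. c u * \<phi> u)) {a..b}"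
    using \<phi>(2)[of a] \<phi>(2)[of b] by (simp add: h_def sum_negf)
  then show ?thesis
  proof (rule has_integral_spike_finite[OF T, rotated])
    fix x assume "x \<in> {a..b} - T"
    then show "f x * \<phi>' x + \<phi> x * D x = h' x"
      by (simp add: f h'_def sum_distrib_left sum_distrib_right algebra_simps)
  qed
qed

lemma test_function_zero:
  assumes "test_function U \<phi> D\<phi>" "x \<notin> U"
  shows "\<phi> x = 0" "D\<phi> x = 0"
proof -
  have sub: "closure {x. \<phi> x \<noteq> 0} \<subseteq> U" and der: "(\<phi> has_derivative (\<lambda>h. D\<phi> x \<bullet> h)) (at x)"
    using assms(1) by (auto simp: test_function_def)
  have x: "x \<in> - closure {x. \<phi> x \<noteq> 0}" using sub assms(2) by auto
  then show "\<phi> x = 0" using closure_subset[of "{x. \<phi> x \<noteq> 0}"] by blast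
  have "(\<phi> has_derivative (\<lambda>h. 0)) (at x)"
    by (rule has_derivative_transform_within_open[of "\<lambda>_. 0" _ _ _ "- closure {x. \<phi> x \<noteq> 0}"])
       (use x closure_subset[of "{x. \<phi> x \<noteq> 0}"] in auto)
  then have "(\<lambda>h. D\<phi> x \<bullet> h) = (\<lambda>h. 0)"
    using der has_derivative_unique by blast
  then show "D\<phi> x = 0"
    by (metis inner_eq_zero_iff)
qed

lemma test_function_bounded:
  assumes "test_function U \<phi> D\<phi>"
  obtains B where "\<And>x. \<bar>\<phi> x\<bar> \<le> B" "\<And>x. norm (D\<phi> x) \<le> B"
proof -
  let ?C = "closure {x. \<phi> x \<noteq> 0}"
  have C: "compact ?C" and cD: "continuous_on UNIV D\<phi>" and der: "\<And>x. (\<phi> has_derivative (\<lambda>h. D\<phi> x \<bullet> h)) (at x)"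
    using assms by (auto simp: test_function_def)
  have c\<phi>: "continuous_on UNIV \<phi>"
    using der by (meson continuous_at_imp_continuous_on has_derivative_continuous)
  have "bounded (\<phi> ` ?C)" "bounded (D\<phi> ` ?C)"
    using C cD c\<phi> by (meson compact_continuous_image compact_imp_bounded continuous_on_subset subset_UNIV)+
  then obtain B1 B2 where B: "\<And>x. x \<in> ?C \<Longrightarrow> norm (\<phi> x) \<le> B1" "\<And>x. x \<in> ?C \<Longrightarrow> norm (D\<phi> x) \<le> B2"
    unfolding bounded_iff by blast
  \<comment> \<open>Replacing \<open>U\<close> by the support makes both functions vanish off a
    compact set, so bounds there are global.\<close>
  have t: "test_function ?C \<phi> D\<phi>"
    using assms by (auto simp: test_function_def)
  show thesis
  proof (rule that[of "max 0 (max B1 B2)"])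
    show "\<bar>\<phi> x\<bar> \<le> max 0 (max B1 B2)" "norm (D\<phi> x) \<le> max 0 (max B1 B2)" for x
      using B[of x] test_function_zero[OF t, of x] by (cases "x \<in> ?C"; fastforce)+
  qed
qed

text \<open>Turns a matrix density \<open>J\<close> against a positive measure into polar form: the
  total variation is \<open>norm (J x)\<close> times \<open>\<nu>\<close> on \<open>U\<close>, and
  the direction is \<open>sgn (J x)\<close>. Finiteness of the new measure comes from integrability
  of the weight, so \<open>\<nu>\<close> may be infinite. Only points of \<open>U\<close> with
  \<open>J x \<noteq> 0\<close> are charged, and there \<open>P\<close> holds.\<close>

lemma derivative_decomposition_polar:
  fixes u :: "real^'n \<Rightarrow> real^'m"
  assumes U: "U \<in> sets borel" and g: "g absolutely_integrable_on U"
    and \<nu>: "sets \<nu> = sets borel" and J: "J \<in> borel_measurable borel"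
    and int: "integrable \<nu> (\<lambda>x. indicator U x * norm (J x))"
    and N: "N \<in> null_sets lborel" "emeasure \<nu> (- N) = 0"
    and parts: "\<And>\<phi> D\<phi> i j. test_function U \<phi> D\<phi> \<Longrightarrow>
      (LINT x:U|lebesgue. u x $ i * D\<phi> x $ j)
        = - ((LINT x:U|lebesgue. \<phi> x * g x $ i $ j) + (LINT x|\<nu>. \<phi> x * J x $ i $ j))"
    and P: "\<And>x. x \<in> U \<Longrightarrow> J x \<noteq> 0 \<Longrightarrow> P x"
  shows "\<exists>\<mu> \<sigma>. derivative_decomposition U u g \<mu> \<sigma> \<and> (AE x in \<mu>. P x)"
proof (intro exI conjI)
  let ?w = "\<lambda>x. indicator U x * norm (J x)"
  let ?\<mu> = "density \<nu> (\<lambda>x. ennreal (?w x))" and ?\<sigma> = "\<lambda>x. sgn (J x)"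
  have [measurable_cong]: "sets \<nu> = sets borel" by fact
  have [measurable]: "J \<in> borel_measurable borel" "U \<in> sets borel" "J \<in> borel_measurable \<nu>" "N \<in> sets borel" "U \<in> sets \<nu>"
    using U J N \<nu> by (auto simp: null_sets_def cong: measurable_cong_sets)
  have sp: "space \<nu> = UNIV" using sets_eq_imp_space_eq[OF \<nu>] by simp
  have wm[measurable]: "?w \<in> borel_measurable \<nu>" by measurable
  show "AE x in ?\<mu>. P x"
    using P by (subst AE_density) (auto simp: indicator_def split: if_splits)
  show "derivative_decomposition U u g ?\<mu> ?\<sigma>"
    unfolding derivative_decomposition_def
  proof (intro conjI allI impI)
    show "finite_measure ?\<mu>"
    proof
      have "emeasure ?\<mu> (space ?\<mu>) = (\<integral>\<^sup>+x. ennreal (?w x) \<partial>\<nu>)"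
        by (simp add: emeasure_density sp)
      also have "\<dots> < \<infinity>"
        using int by (simp add: integrable_iff_bounded abs_mult)
      finally show "emeasure ?\<mu> (space ?\<mu>) \<noteq> \<infinity>" by simp
    qed
    show "emeasure ?\<mu> (- U) = 0"
      by (subst emeasure_density) (auto simp: nn_integral_0_iff_AE indicator_def intro!: AE_I2)
    have "emeasure ?\<mu> (- N) = 0"
    proof -
      have "- N \<in> null_sets \<nu>"
        using N \<nu> by (auto simp: null_sets_def)
      then show ?thesis
        using wm by (subst emeasure_density) (auto simp: nn_integral_null_set)
    qed
    then show "\<exists>N \<in> null_sets lborel. emeasure ?\<mu> (- N) = 0" using N by blast
    show "AE x in ?\<mu>. norm (?\<sigma> x) = 1"
      by (subst AE_density) (auto simp: norm_sgn)
    show "?\<sigma> \<in> borel_measurable borel"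
      unfolding sgn_div_norm by measurable
    fix \<phi> D\<phi> i j assume t: "test_function U \<phi> D\<phi>"
    have "continuous_on UNIV \<phi>"
      using t unfolding test_function_def by (meson continuous_at_imp_continuous_on has_derivative_continuous)
    then have [measurable]: "\<phi> \<in> borel_measurable \<nu>"
      by (simp add: borel_measurable_continuous_onI \<nu> cong: measurable_cong_sets)
    have "(LINT x|?\<mu>. \<phi> x * ?\<sigma> x $ i $ j) = (LINT x|\<nu>. ?w x *\<^sub>R (\<phi> x * ?\<sigma> x $ i $ j))"
      unfolding sgn_div_norm by (rule integral_density) (auto simp: indicator_def)
    also have "\<dots> = (LINT x|\<nu>. \<phi> x * J x $ i $ j)"
    proof (rule Bochner_Integration.integral_cong[OF refl])
      \<comment> \<open>Where \<open>J x = 0\<close> both sides are 0, since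
        \<open>sgn 0 = 0\<close>; off \<open>U\<close> both vanish with
        \<open>\<phi>\<close>.\<close>
      show "?w x *\<^sub>R (\<phi> x * ?\<sigma> x $ i $ j) = \<phi> x * J x $ i $ j" for x
        using test_function_zero(1)[OF t, of x] by (cases "J x = 0") (auto simp: indicator_def sgn_div_norm)
    qed
    finally show "(LINT x:U|lebesgue. u x $ i * D\<phi> x $ j) =
        - ((LINT x:U|lebesgue. \<phi> x * g x $ i $ j) + (LINT x|?\<mu>. \<phi> x * ?\<sigma> x $ i $ j))"
      using parts[OF t] by simp
  qed (use g \<nu> in auto)
qed

section \<open>The sawtooth\<close>

text \<open>The discontinuities of \<^term>\<open>wrap h\<close>.\<close>

definition kinks :: "real \<Rightarrow> real set" where
  "kinks h = range (\<lambda>j::int. h * (2 * real_of_int j - 1))"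

lemma countable_kinks: "countable (kinks h)"
  by (simp add: kinks_def)

lemma le_cell_index_iff: "h > 0 \<Longrightarrow> real_of_int j \<le> (s + h) / (2 * h) \<longleftrightarrow> h * (2 * real_of_int j - 1) \<le> s"
  by (simp add: field_simps)

lemma wrap_bounds:
  assumes "h > 0"
  shows "- h \<le> wrap h s" "wrap h s < h" "\<bar>wrap h s\<bar> \<le> h"
proof -
  have "real_of_int \<lfloor>(s + h) / (2 * h)\<rfloor> \<le> (s + h) / (2 * h)" "(s + h) / (2 * h) < real_of_int \<lfloor>(s + h) / (2 * h)\<rfloor> + 1"
    by linarith+
  then have "real_of_int \<lfloor>(s + h) / (2 * h)\<rfloor> * (2 * h) \<le> s + h" "s + h < (real_of_int \<lfloor>(s + h) / (2 * h)\<rfloor> + 1) * (2 * h)"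
    using assms by (simp_all only: pos_le_divide_eq pos_divide_less_eq zero_less_mult_iff zero_less_numeral simp_thms)
  then show "- h \<le> wrap h s" "wrap h s < h"
    by (simp_all add: wrap_def algebra_simps)
  then show "\<bar>wrap h s\<bar> \<le> h" by linarith
qed

lemma wrap_plus_period:
  assumes "h > 0"
  shows "wrap h (s + 2 * h * real_of_int j) = wrap h s"
proof -
  have "(s + 2 * h * real_of_int j + h) / (2 * h) = (s + h) / (2 * h) + real_of_int j"
    using assms by (simp add: field_simps)
  then show ?thesis
    by (simp add: wrap_def algebra_simps)
qed

text \<open>Wrapping with period \<open>2 * (k * h)\<close> shifts by a multiple of
  \<open>2 * h\<close>. This is the reason for column half-widths that divide \<open>L1\<close> and
  \<open>L2\<close>.\<close>

lemma wrap_wrap_multiple: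
  assumes "h > 0"
  shows "wrap h (wrap (real k * h) s) = wrap h s"
proof -
  have "wrap (real k * h) s = s + 2 * h * real_of_int (- (int k * \<lfloor>(s + real k * h) / (2 * (real k * h))\<rfloor>))"
    by (simp add: wrap_def)
  then show ?thesis
    using wrap_plus_period[OF assms] by metis
qed

lemma wrap_has_real_derivative:
  assumes h: "h > 0" and s: "s \<notin> kinks h"
  shows "(wrap h has_real_derivative 1) (at s)"
proof -
  have "(s + h) / (2 * h) \<notin> \<int>"
  proof
    assume "(s + h) / (2 * h) \<in> \<int>"
    then obtain j :: int where "(s + h) / (2 * h) = real_of_int j"
      by (auto elim: Ints_cases)
    then have "s = h * (2 * real_of_int j - 1)"
      using h by (simp add: field_simps)
    then show False using s by (auto simp: kinks_def)
  qed
  moreover have "((\<lambda>x. (x + h) / (2 * h)) \<longlongrightarrow> (s + h) / (2 * h)) (nhds s)"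
    using h by (auto intro!: tendsto_intros filterlim_ident)
  ultimately have "\<forall>\<^sub>F x in nhds s. \<lfloor>(x + h) / (2 * h)\<rfloor> = \<lfloor>(s + h) / (2 * h)\<rfloor>"
    by (intro eventually_floor_eq)
  then have "\<forall>\<^sub>F x in nhds s. wrap h x = x - 2 * h * real_of_int \<lfloor>(s + h) / (2 * h)\<rfloor>"
    by eventually_elim (simp add: wrap_def)
  then show ?thesis
    by (subst DERIV_cong_ev[OF refl _ refl]) (auto intro!: derivative_eq_intros)
qed

text \<open>This makes the continuity of \<open>\<bar>wrap h\<bar>\<close> evident.\<close>

lemma abs_wrap_eq_arccos:
  assumes "h > 0"
  shows "\<bar>wrap h s\<bar> = h / pi * arccos (cos (pi * s / h))"
proof -
  have "pi * wrap h s / h = pi * s / h - 2 * pi * real_of_int \<lfloor>(s + h) / (2 * h)\<rfloor>"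
    using assms by (simp add: wrap_def field_simps)
  moreover have "cos (pi * s / h - 2 * pi * real_of_int n) = cos (pi * s / h)" for n
    unfolding cos_diff cos_int_2pin sin_int_2pin by simp
  ultimately have "cos (pi * s / h) = cos (pi * wrap h s / h)"
    by simp
  also have "\<dots> = cos (pi * \<bar>wrap h s\<bar> / h)"
    by (cases "wrap h s \<ge> 0") simp_all
  finally have "cos (pi * s / h) = cos (pi * \<bar>wrap h s\<bar> / h)" .
  moreover have "arccos (cos (pi * \<bar>wrap h s\<bar> / h)) = pi * \<bar>wrap h s\<bar> / h"
    using wrap_bounds[OF assms, of s] assms by (intro arccos_cos) (auto simp: field_simps)
  ultimately show ?thesis
    using assms by simp
qed

lemma continuous_abs_wrap:
  assumes "h > 0"
  shows "continuous_on A (\<lambda>s. \<bar>wrap h s\<bar>)"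
  unfolding abs_wrap_eq_arccos[OF assms] using assms
  by (intro continuous_intros) auto

text \<open>The sawtooth jumps from \<open>h\<close> to \<open>- h\<close>, which an even function
  does not see; \<open>W\<close> depends on the sawtooth only through squares.\<close>

lemma continuous_wrap_power2:
  assumes "h > 0"
  shows "continuous_on A (\<lambda>s. (wrap h s)\<^sup>2)"
  using continuous_on_power[OF continuous_abs_wrap[OF assms], of A 2] by simp

lemma borel_measurable_wrap [measurable]: "wrap h \<in> borel_measurable borel"
  unfolding wrap_def by measurable

lemma kinks_measurable [measurable]: "kinks h \<in> sets borel"
  by (rule sets.countable[OF _ countable_kinks]) simp

text \<open>Chosen such that the kinks with indices in \<open>{- kink_count h R + 1..kink_count h R}\<close> include all those
  in \<open>(-R, R)\<close>.\<close>

definition kink_count :: "real \<Rightarrow> real \<Rightarrow> int" where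
  "kink_count h R = \<lceil>R / h\<rceil> + 1"

definition kinks_upto :: "real \<Rightarrow> real \<Rightarrow> real set" where
  "kinks_upto h R = (\<lambda>j::int. h * (2 * real_of_int j - 1)) ` {- kink_count h R + 1..kink_count h R}"

lemma finite_kinks_upto: "finite (kinks_upto h R)"
  by (simp add: kinks_upto_def)

lemma kinks_upto_subset: "kinks_upto h R \<subseteq> kinks h"
  by (auto simp: kinks_upto_def kinks_def)

text \<open>With \<open>M = kink_count h R\<close> the listed kinks run symmetrically from
  \<open>- h * (2 * M - 1)\<close> to \<open>h * (2 * M - 1)\<close>; the first estimate puts both
  extremes at distance at least \<open>R\<close> from 0.\<close>

lemma kink_count_ge:
  assumes "h > 0" "R > 0"
  shows "R \<le> h * (2 * real_of_int (kink_count h R) - 1)" "real_of_int (kink_count h R) \<le> R / h + 2" "kink_count h R \<ge> 1"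
proof -
  have c: "R / h \<le> real_of_int \<lceil>R / h\<rceil>" "real_of_int \<lceil>R / h\<rceil> < R / h + 1" by linarith+
  then show "real_of_int (kink_count h R) \<le> R / h + 2" by (simp add: kink_count_def)
  have p: "R / h > 0" using assms by simp
  then have "\<lceil>R / h\<rceil> \<ge> 0" by linarith
  then show "kink_count h R \<ge> 1" by (simp add: kink_count_def)
  have "R = h * (R / h)" using assms by simp
  also have "\<dots> \<le> h * (2 * real_of_int (kink_count h R) - 1)"
  proof (rule mult_left_mono)
    show "R / h \<le> 2 * real_of_int (kink_count h R) - 1"
      using c(1) p unfolding kink_count_def of_int_add of_int_1 by argo
  qed (use assms in simp)
  finally show "R \<le> h * (2 * real_of_int (kink_count h R) - 1)" .
qed

lemma kinks_in_kinks_upto: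
  assumes h: "h > 0" "R > 0" and s: "s \<in> kinks h" "\<bar>s\<bar> < R"
  shows "s \<in> kinks_upto h R"
proof -
  obtain j :: int where j: "s = h * (2 * real_of_int j - 1)" using s by (auto simp: kinks_def)
  let ?M = "kink_count h R"
  have "\<bar>s\<bar> < h * (2 * real_of_int ?M - 1)" using kink_count_ge(1)[OF h] s by simp
  then have "h * (2 * real_of_int j - 1) < h * (2 * real_of_int ?M - 1)" "h * (- (2 * real_of_int ?M - 1)) < h * (2 * real_of_int j - 1)"
    unfolding j by (auto simp: abs_less_iff algebra_simps)
  then have "2 * real_of_int j - 1 < 2 * real_of_int ?M - 1" "- (2 * real_of_int ?M - 1) < 2 * real_of_int j - 1"
    using h(1) by (simp_all only: mult_less_cancel_left_pos)
  then have "- ?M + 1 \<le> j" "j \<le> ?M" by linarith+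
  then show ?thesis by (auto simp: kinks_upto_def j)
qed

lemma card_kinks_upto:
  assumes "h > 0" "R > 0"
  shows "real (card (kinks_upto h R)) \<le> 2 * R / h + 4"
proof -
  have "card (kinks_upto h R) \<le> card {- kink_count h R + 1..kink_count h R}"
    unfolding kinks_upto_def by (rule card_image_le) simp
  then have "real (card (kinks_upto h R)) \<le> 2 * real_of_int (kink_count h R)"
    using kink_count_ge(3)[OF assms] by simp
  then show ?thesis
    using kink_count_ge(2)[OF assms] by simp
qed

text \<open>The floor in \<open>wrap\<close> is the number of listed kinks not exceeding
  \<open>s\<close>, minus \<open>kink_count h R\<close>. So the sawtooth is a line of slope 1 with a
  drop of \<open>2 * h\<close> at each kink; half-open cells make this exact at the kinks
  too.\<close>

lemma wrap_eq_sum_jumps: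
  assumes h: "h > 0" "R > 0" and s: "s \<in> {-R..R}"
  shows "wrap h s = s + 2 * h * real_of_int (kink_count h R) - 2 * h * (\<Sum>u\<in>kinks_upto h R. of_bool (u \<le> s))"
proof -
  let ?M = "kink_count h R" and ?n = "\<lfloor>(s + h) / (2 * h)\<rfloor>"
  have inj: "inj_on (\<lambda>j::int. h * (2 * real_of_int j - 1)) A" for A
    using h by (auto simp: inj_on_def)
  have "s \<le> h * (2 * real_of_int ?M - 1)" "- (h * (2 * real_of_int ?M - 1)) \<le> s"
    using s kink_count_ge(1)[OF h] by auto
  then have "(s + h) / (2 * h) \<le> real_of_int ?M" "real_of_int (- ?M + 1) \<le> (s + h) / (2 * h)"
    using h by (simp_all add: field_simps)
  then have n: "?n \<le> ?M" "- ?M + 1 \<le> ?n"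
    by linarith+
  have "(\<Sum>u\<in>kinks_upto h R. of_bool (u \<le> s) :: real)
      = (\<Sum>j\<in>{- ?M + 1..?M}. of_bool (h * (2 * real_of_int j - 1) \<le> s))"
    unfolding kinks_upto_def by (subst sum.reindex[OF inj]) simp
  also have "\<dots> = (\<Sum>j\<in>{- ?M + 1..?M}. of_bool (j \<le> ?n))"
    using h by (simp add: le_cell_index_iff[symmetric] le_floor_iff)
  also have "\<dots> = real (card {- ?M + 1..?n})"
  proof -
    have "{- ?M + 1..?M} \<inter> {j. j \<le> ?n} = {- ?M + 1..?n}" using n by auto
    then show ?thesis by (simp add: sum.If_cases of_bool_def)
  qed
  also have "\<dots> = real_of_int ?n + real_of_int ?M"
    using n by simp
  finally show ?thesis
    by (simp add: wrap_def algebra_simps)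
qed

section \<open>One-dimensional integration by parts for the profiles of the field\<close>

lemma has_integral_by_parts_const:
  fixes \<phi> \<phi>' :: "real \<Rightarrow> real"
  assumes "R > 0" "\<And>s. (\<phi> has_real_derivative \<phi>' s) (at s)" "\<And>s. s \<notin> {-R<..<R} \<Longrightarrow> \<phi> s = 0"
  shows "((\<lambda>s. k * \<phi>' s) has_integral 0) {-R..R}"
  using has_integral_by_parts_jumps[of "-R" R "{}" "{}" "\<lambda>_. k" "\<lambda>_. 0" \<phi> \<phi>' "\<lambda>_. k" "\<lambda>_. 0"] assms
  by (simp add: continuous_on_const)

lemma has_integral_by_parts_wrap:
  fixes \<phi> \<phi>' :: "real \<Rightarrow> real"
  assumes h: "h > 0" "R > 0" and \<phi>: "\<And>s. (\<phi> has_real_derivative \<phi>' s) (at s)" "\<And>s. s \<notin> {-R<..<R} \<Longrightarrow> \<phi> s = 0"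
  shows "((\<lambda>s. k * wrap h s * \<phi>' s + \<phi> s * k) has_integral - (\<Sum>u\<in>kinks_upto h R. - 2 * h * k * \<phi> u)) {-R..R}"
proof (rule has_integral_by_parts_jumps[where T = "{}" and fc = "\<lambda>s. k * s + k * (2 * h * real_of_int (kink_count h R))"])
  show "k * wrap h s = k * s + k * (2 * h * real_of_int (kink_count h R)) + (\<Sum>u\<in>kinks_upto h R. - 2 * h * k * of_bool (u \<le> s))"
    if "s \<in> {-R..R} - {}" for s
    using that unfolding sum_distrib_left[symmetric] by (subst wrap_eq_sum_jumps[OF h]) (simp_all add: algebra_simps)
qed (use assms in \<open>auto simp: finite_kinks_upto intro!: continuous_intros derivative_eq_intros\<close>)

text \<open>The square root is continuous, so the kinks enter only as exceptional points
  \<open>T\<close> of differentiability and not as jumps \<open>S\<close>; hence the boundary sum is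
  empty.\<close>

lemma has_integral_by_parts_sqrt_wrap:
  fixes \<phi> \<phi>' :: "real \<Rightarrow> real"
  assumes h: "h > 0" "R > 0" and \<phi>: "\<And>s. (\<phi> has_real_derivative \<phi>' s) (at s)" "\<And>s. s \<notin> {-R<..<R} \<Longrightarrow> \<phi> s = 0"
    and pos: "\<And>s. b - (t * wrap h s)\<^sup>2 > 0"
  shows "((\<lambda>s. sqrt (b - (t * wrap h s)\<^sup>2) * \<phi>' s + \<phi> s * (- (t * (t * wrap h s) / sqrt (b - (t * wrap h s)\<^sup>2)))) has_integral 0) {-R..R}"
proof -
  have "((\<lambda>s. sqrt (b - (t * wrap h s)\<^sup>2) * \<phi>' s + \<phi> s * (- (t * (t * wrap h s) / sqrt (b - (t * wrap h s)\<^sup>2))))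
      has_integral - (\<Sum>u\<in>{}. 0 * \<phi> u)) {-R..R}"
  proof (rule has_integral_by_parts_jumps[where T = "kinks_upto h R" and fc = "\<lambda>s. sqrt (b - (t * wrap h s)\<^sup>2)"])
    show "continuous_on {-R..R} (\<lambda>s. sqrt (b - (t * wrap h s)\<^sup>2))"
      unfolding power_mult_distrib by (intro continuous_intros continuous_wrap_power2 h)
    fix s assume "s \<in> {-R<..<R} - kinks_upto h R"
    then have "s \<notin> kinks h" using kinks_in_kinks_upto[OF h] by auto
    then show "((\<lambda>s. sqrt (b - (t * wrap h s)\<^sup>2)) has_real_derivative - (t * (t * wrap h s) / sqrt (b - (t * wrap h s)\<^sup>2))) (at s)"
      using wrap_has_real_derivative[OF h(1), of s] pos[of s]
      by (auto intro!: derivative_eq_intros simp: field_simps power2_eq_square)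
  qed (use assms in \<open>auto simp: finite_kinks_upto\<close>)
  then show ?thesis by simp
qed

lemma has_integral_by_parts_slab:
  fixes \<phi> \<phi>' :: "real \<Rightarrow> real"
  assumes d: "d > 0" "d < R" and \<phi>: "\<And>s. (\<phi> has_real_derivative \<phi>' s) (at s)" "\<And>s. s \<notin> {-R<..<R} \<Longrightarrow> \<phi> s = 0"
  shows "((\<lambda>s. (if s \<le> 0 then a else if d \<le> s then c else b) * \<phi>' s) has_integral - ((b - a) * \<phi> 0 + (c - b) * \<phi> d)) {-R..R}"
proof -
  have "((\<lambda>s. (if s \<le> 0 then a else if d \<le> s then c else b) * \<phi>' s + \<phi> s * 0)
      has_integral - (\<Sum>u\<in>{0, d}. (if u = 0 then b - a else c - b) * \<phi> u)) {-R..R}"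
    \<comment> \<open>At 0 the step function still has its left value \<open>a\<close>, while the
      jump sum already counts the jump there; \<open>T\<close> exempts this point.\<close>
    by (rule has_integral_by_parts_jumps[where T = "{0, d}" and fc = "\<lambda>_. a"])
       (use assms in \<open>auto\<close>)
  then show ?thesis using d by simp
qed

section \<open>The double-twist competitor\<close>

lemma borel_measurable_vecI:
  fixes f :: "'a \<Rightarrow> 'b::euclidean_space ^ 'n"
  assumes "\<And>i. (\<lambda>x. f x $ i) \<in> borel_measurable M"
  shows "f \<in> borel_measurable M"
proof (subst borel_measurable_euclidean_space, intro ballI)
  fix b :: "'b ^ 'n" assume "b \<in> Basis"
  then obtain i c where b: "b = axis i c" by (auto simp: Basis_vec_def)
  show "(\<lambda>x. f x \<bullet> b) \<in> borel_measurable M"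
    unfolding b inner_axis using assms[of i] by measurable
qed

lemma borel_measurable_vector3 [measurable (raw)]:
  fixes f g h :: "'a \<Rightarrow> 'b::euclidean_space"
  assumes "f \<in> borel_measurable M" "g \<in> borel_measurable M" "h \<in> borel_measurable M"
  shows "(\<lambda>x. vector [f x, g x, h x] :: 'b ^ 3) \<in> borel_measurable M"
proof (rule borel_measurable_vecI)
  show "(\<lambda>x. (vector [f x, g x, h x] :: 'b ^ 3) $ i) \<in> borel_measurable M" for i
    using exhaust_3[of i] assms by auto
qed

text \<open>The compared balls have radius \<open>r / 2\<close> and touch at \<open>x\<close> the
  hyperplane through \<open>x\<close> normal to axis \<open>k\<close>, one from each side; the
  translation by \<open>r\<close> along the normal carries one onto the other.\<close>

lemma jump_no_approx_limit_axis:
  fixes u :: "real^'n \<Rightarrow> real^'m"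
  assumes int: "\<forall>\<^sub>F r in at_right 0. u absolutely_integrable_on ball x r" and c: "c > 0" and \<rho>: "\<rho> > 0"
    and jump: "\<And>r y. 0 < r \<Longrightarrow> r < \<rho> \<Longrightarrow> x $ k - r < y $ k \<Longrightarrow> y $ k < x $ k \<Longrightarrow> dist y x < r \<Longrightarrow>
      c \<le> norm (u y - u (y + r *\<^sub>R axis k 1))"
  shows "\<not> has_approx_limit u a x"
proof (rule jump_no_approx_limit[OF int c])
  show "\<forall>\<^sub>F r in at_right 0. \<exists>v w. norm v \<le> r / 2 \<and> norm w \<le> r / 2 \<and>
      (\<forall>y \<in> ball (x + v) (r / 2). c \<le> norm (u y - u (y + (w - v))))"
    unfolding eventually_at_right_field
  proof (intro exI[of _ \<rho>] conjI allI impI)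
    fix r :: real assume r: "0 < r" "r < \<rho>"
    let ?e = "axis k 1 :: real^'n"
    show "\<exists>v w. norm v \<le> r / 2 \<and> norm w \<le> r / 2 \<and>
      (\<forall>y \<in> ball (x + v) (r / 2). c \<le> norm (u y - u (y + (w - v))))"
    proof (rule exI[of _ "- (r / 2) *\<^sub>R ?e"], rule exI[of _ "(r / 2) *\<^sub>R ?e"], intro conjI ballI)
      fix y assume "y \<in> ball (x + - (r / 2) *\<^sub>R ?e) (r / 2)"
      then have y: "norm (y - x + (r / 2) *\<^sub>R ?e) < r / 2"
        by (simp add: dist_norm norm_minus_commute algebra_simps)
      have "\<bar>(y - x + (r / 2) *\<^sub>R ?e) $ k\<bar> < r / 2"
        using y component_le_norm_cart[of "y - x + (r / 2) *\<^sub>R ?e" k] by linarith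
      then have "\<bar>y $ k - x $ k + r / 2\<bar> < r / 2"
        by (simp add: axis_def)
      moreover have "dist y x \<le> norm (y - x + (r / 2) *\<^sub>R ?e) + norm ((r / 2) *\<^sub>R ?e)"
        using norm_triangle_ineq4[of "y - x + (r / 2) *\<^sub>R ?e" "(r / 2) *\<^sub>R ?e"] by (simp add: dist_norm)
      then have "dist y x < r"
        using y r by simp
      ultimately have "c \<le> norm (u y - u (y + r *\<^sub>R ?e))"
        using r by (intro jump) linarith+
      moreover have "(r / 2) *\<^sub>R ?e - - (r / 2) *\<^sub>R ?e = r *\<^sub>R ?e"
        by (simp add: scaleR_left_distrib[symmetric])
      ultimately show "c \<le> norm (u y - u (y + ((r / 2) *\<^sub>R ?e - - (r / 2) *\<^sub>R ?e)))"
        by simp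
    qed (use r in auto)
  qed (use \<rho> in auto)
qed

text \<open>\<open>y\<close> and \<open>y + r\<close> lie in adjacent cells, so the drop
  \<open>2 * h\<close> is reduced by the rise \<open>r\<close> of the linear part.\<close>

lemma wrap_jump:
  assumes h: "h > 0" and s: "s \<in> kinks h" and r: "0 < r" "r < h" "s - r < y" "y < s"
  shows "wrap h y - wrap h (y + r) = 2 * h - r"
proof -
  obtain j :: int where j: "s = h * (2 * real_of_int j - 1)" using s by (auto simp: kinks_def)
  have 1: "\<lfloor>(y + h) / (2 * h)\<rfloor> = j - 1"
    by (rule floor_unique) (use h r in \<open>simp_all add: j field_simps\<close>)
  have 2: "\<lfloor>(y + r + h) / (2 * h)\<rfloor> = j"
    by (rule floor_unique) (use h r in \<open>simp_all add: j field_simps\<close>)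
  show ?thesis
    unfolding wrap_def 1 2 by (simp add: algebra_simps)
qed

lemma mem_Icc_Times_iff: "q \<in> {-R..R} \<times> {-R..R} \<longleftrightarrow> \<bar>fst q\<bar> \<le> R \<and> \<bar>snd q\<bar> \<le> R" for R :: real
  by (cases q) (auto simp: abs_le_iff)

text \<open>\<open>h1\<close> and \<open>h2\<close> are half-widths of the columns.
  \<open>L1\<close> and \<open>L2\<close> are left out on purpose: the field lives on the whole
  space, and the cell enters only when the extension is formed.\<close>

locale double_twist =
  fixes d t h1 h2 :: real
  assumes d: "d > 0" and t: "t > 0" and h1: "h1 > 0" and h2: "h2 > 0"
    and th1: "t * h1 \<le> 1 / 4" and th2: "t * h2 \<le> 1 / 4"
begin

definition X :: "real^3 \<Rightarrow> real" where "X p = t * wrap h1 (p $ 1)"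
definition Y :: "real^3 \<Rightarrow> real" where "Y p = t * wrap h2 (p $ 2)"
definition W :: "real^3 \<Rightarrow> real" where "W p = sqrt (1 - (Y p)\<^sup>2 - (X p)\<^sup>2)"

text \<open>The boundary values are part of the field, with the conventions of \<open>extend\<close>
  at heights 0 and \<open>d\<close>. Thus membership on \<open>Omega\<close> and on bounded pieces
  of the extended domain are the same statement about one map.\<close>

definition field :: "real^3 \<Rightarrow> real^3" where
  "field p = (if p $ 3 \<le> 0 then axis 1 1 else if d \<le> p $ 3 then axis 3 1 else vector [Y p, - X p, W p])"

definition grad :: "real^3 \<Rightarrow> real^3^3" where
  "grad p = (if 0 < p $ 3 \<and> p $ 3 < d
     then vector [vector [0, t, 0], vector [- t, 0, 0], vector [- (t * X p / W p), - (t * Y p / W p), 0]]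
     else 0)"

text \<open>The jump of \<open>field\<close> tensored with the unit normal; the third component of \<open>field\<close> is
  continuous across the lateral faces of the columns.\<close>

definition jump :: "real^3 \<Rightarrow> real^3^3" where
  "jump p =
     (if 0 < p $ 3 \<and> p $ 3 < d
      then vector [vector [0, if p $ 2 \<in> kinks h2 then - 2 * h2 * t else 0, 0],
                   vector [if p $ 1 \<in> kinks h1 then 2 * h1 * t else 0, 0, 0], 0]
      else if p $ 3 = 0 then vector [vector [0, 0, Y p - 1], vector [0, 0, - X p], vector [0, 0, W p]]
      else if p $ 3 = d then vector [vector [0, 0, - Y p], vector [0, 0, X p], vector [0, 0, 1 - W p]]
      else 0)"

text \<open>Contains the discontinuity set but may exceed it: the column axes meet the top plane
  where the field attains its boundary value continuously and \<open>jump\<close> is 0. A superset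
  is enough for area bounds.\<close>

definition jump_planes :: "(real^3) set" where
  "jump_planes = {p. p $ 3 \<in> {0, d} \<or> 0 < p $ 3 \<and> p $ 3 < d \<and> (p $ 1 \<in> kinks h1 \<or> p $ 2 \<in> kinks h2)}"

section \<open>Pointwise bounds and measurability of the field\<close>

lemma X_bound: "\<bar>X p\<bar> \<le> 1 / 4"
proof -
  have "\<bar>X p\<bar> \<le> t * h1"
    using wrap_bounds(3)[OF h1, of "p $ 1"] t by (simp add: X_def abs_mult)
  then show ?thesis using th1 by linarith
qed

lemma Y_bound: "\<bar>Y p\<bar> \<le> 1 / 4"
proof -
  have "\<bar>Y p\<bar> \<le> t * h2"
    using wrap_bounds(3)[OF h2, of "p $ 2"] t by (simp add: Y_def abs_mult)
  then show ?thesis using th2 by linarith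
qed

lemma X2_bound: "(X p)\<^sup>2 \<le> 1 / 16" and Y2_bound: "(Y p)\<^sup>2 \<le> 1 / 16"
  using abs_le_square_iff[of "X p" "1 / 4"] abs_le_square_iff[of "Y p" "1 / 4"] X_bound[of p] Y_bound[of p]
  by (simp_all add: power2_eq_square)

lemma W_radicand_pos: "0 < 1 - (Y p)\<^sup>2 - (X p)\<^sup>2"
  using X2_bound[of p] Y2_bound[of p] by simp

lemma W2: "(W p)\<^sup>2 = 1 - (Y p)\<^sup>2 - (X p)\<^sup>2"
  using X2_bound[of p] Y2_bound[of p] by (simp add: W_def)

text \<open>The radicand is at least 1 - 2/16 = 7/8, which exceeds (9/10)^2 = 81/100.\<close>

lemma W_lower: "9 / 10 \<le> W p"
  unfolding W_def by (rule real_le_rsqrt) (use X2_bound[of p] Y2_bound[of p] in \<open>simp add: power2_eq_square\<close>)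

lemma W_upper: "W p \<le> 1"
  by (rule power2_le_imp_le) (use W2[of p] in \<open>auto intro: order_trans\<close>)

lemma measurable_XYW [measurable]:
  "X \<in> borel_measurable borel" "Y \<in> borel_measurable borel" "W \<in> borel_measurable borel"
proof -
  have "(\<lambda>p. t * wrap h (p $ i)) \<in> borel_measurable borel" for h and i :: 3
    by measurable
  then show [measurable]: "X \<in> borel_measurable borel" "Y \<in> borel_measurable borel"
    unfolding X_def Y_def by blast+
  show "W \<in> borel_measurable borel"
    unfolding W_def by measurable
qed

lemma measurable_field [measurable]: "field \<in> borel_measurable borel"
  unfolding field_def by measurable

lemma measurable_grad [measurable]: "grad \<in> borel_measurable borel"
  unfolding grad_def by measurable

lemma measurable_jump [measurable]: "jump \<in> borel_measurable borel"
  unfolding jump_def by measurable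

lemma norm_field: "norm (field p) = 1"
proof -
  have "(norm (field p))\<^sup>2 = 1"
    using W2[of p] by (auto simp: field_def power2_norm_vec3 axis_def)
  then show ?thesis
    using norm_ge_zero[of "field p"] unfolding power2_eq_1_iff by linarith
qed

lemma norm_grad: "norm (grad p) \<le> 2 * t"
proof (rule power2_le_imp_le)
  have "\<bar>X p / W p\<bar> \<le> 1" "\<bar>Y p / W p\<bar> \<le> 1"
    using X_bound[of p] Y_bound[of p] W_lower[of p] by (simp_all add: abs_divide divide_le_eq_1)
  then have "(X p / W p)\<^sup>2 \<le> 1" "(Y p / W p)\<^sup>2 \<le> 1"
    by (simp_all only: abs_square_le_1)
  then have "t\<^sup>2 * (X p / W p)\<^sup>2 \<le> t\<^sup>2 * 1" "t\<^sup>2 * (Y p / W p)\<^sup>2 \<le> t\<^sup>2 * 1"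
    by (intro mult_left_mono; simp)+
  then show "(norm (grad p))\<^sup>2 \<le> (2 * t)\<^sup>2"
    by (auto simp: grad_def power2_norm_matrix3 power_mult_distrib power_divide)
qed (use t in simp)

lemma abs_integrable_field:
  assumes "U \<in> sets borel" "bounded U"
  shows "field absolutely_integrable_on U"
proof -
  have "integrable lborel (\<lambda>p. indicator U p *\<^sub>R field p)"
    using assms by (intro integrable_lborel_bounded[where B = 1 and A = U])
      (auto simp: norm_field indicator_def)
  then show ?thesis
    unfolding set_integrable_def by (rule integrable_completion[THEN iffD2, rotated]) (use assms in auto)
qed

lemma eventually_integrable_field: "\<forall>\<^sub>F r in at_right 0. field absolutely_integrable_on ball x r"
  by (intro always_eventually allI abs_integrable_field) auto

lemma jump_planes_measurable [measurable]: "jump_planes \<in> sets borel"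
  unfolding jump_planes_def by measurable

lemma negligible_kink_planes: "negligible {p :: real^3. p $ 1 \<in> kinks h1 \<or> p $ 2 \<in> kinks h2 \<or> p $ 3 \<in> {0, d}}"
proof -
  have "negligible {p :: real^3. p $ i = s}" for s and i :: 3
    using negligible_standard_hyperplane[of "axis i 1 :: real^3" s] by (simp add: inner_axis axis_in_Basis_iff)
  then have *: "negligible (\<Union>s\<in>K. {p :: real^3. p $ i = s})" if "countable K" for K and i :: 3
    using that by (intro negligible_countable_Union) auto
  have "negligible ((\<Union>s\<in>kinks h1. {p :: real^3. p $ 1 = s}) \<union> ((\<Union>s\<in>kinks h2. {p. p $ 2 = s}) \<union> (\<Union>s\<in>{0, d}. {p. p $ 3 = s})))"
    by (intro negligible_Un * countable_kinks) auto
  then show ?thesis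
    by (rule negligible_subset) auto
qed

lemma negligible_jump_planes: "negligible jump_planes"
  by (rule negligible_subset[OF negligible_kink_planes]) (auto simp: jump_planes_def)

section \<open>Classical derivative of the field off the jump planes\<close>

lemma has_derivative_twist:
  assumes "p $ 1 \<notin> kinks h1" "p $ 2 \<notin> kinks h2"
  shows "((\<lambda>p. vector [Y p, - X p, W p]) has_derivative
     (\<lambda>v. vector [t * v $ 2, - (t * v $ 1), - (t * X p / W p) * v $ 1 - t * Y p / W p * v $ 2] :: real^3)) (at p)"
proof -
  have wrap: "((\<lambda>p :: real^3. t * wrap h (p $ i)) has_derivative (\<lambda>v. t * v $ i)) (at p)"
    if "h > 0" "p $ i \<notin> kinks h" for h i
  proof (rule has_derivative_mult_right)
    show "((\<lambda>p :: real^3. wrap h (p $ i)) has_derivative (\<lambda>v. v $ i)) (at p)"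
      using has_derivative_compose[OF bounded_linear_imp_has_derivative[OF bounded_linear_vec_nth[of i]]
          wrap_has_real_derivative[OF that, unfolded has_field_derivative_def]] by simp
  qed
  have DX: "(X has_derivative (\<lambda>v. t * v $ 1)) (at p)" and DY: "(Y has_derivative (\<lambda>v. t * v $ 2)) (at p)"
    unfolding X_def Y_def using assms h1 h2 by (auto intro: wrap)
  have DW: "(W has_derivative (\<lambda>v. - (t * X p / W p) * v $ 1 - t * Y p / W p * v $ 2)) (at p)"
    unfolding W_def using W_radicand_pos[of p] by (auto intro!: derivative_eq_intros DX DY simp: fun_eq_iff field_simps)
  have eq: "vector [a, b, c] = a *\<^sub>R axis 1 1 + b *\<^sub>R axis 2 1 + c *\<^sub>R (axis 3 1 :: real^3)" for a b c
    by (simp add: vec_eq_iff forall_3 axis_def)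
  show ?thesis
    unfolding eq by (intro derivative_intros DX DY DW)
qed

lemma has_derivative_field:
  assumes p: "p \<notin> jump_planes"
  shows "(field has_derivative (\<lambda>v. grad p *v v)) (at p)"
proof -
  consider "p $ 3 < 0" | "d < p $ 3" | "0 < p $ 3" "p $ 3 < d"
    using p by (force simp: jump_planes_def)
  then show ?thesis
  proof cases
    case 1
    have "(field has_derivative (\<lambda>v. 0)) (at p)"
      by (rule has_derivative_transform_within_open[of "\<lambda>_. axis 1 1" _ _ _ "{p. p $ 3 < 0}"])
        (use 1 in \<open>auto simp: field_def open_halfspace_component_lt_cart\<close>)
    then show ?thesis using 1 by (simp add: grad_def)
  next
    case 2
    have "(field has_derivative (\<lambda>v. 0)) (at p)"
      by (rule has_derivative_transform_within_open[of "\<lambda>_. axis 3 1" _ _ _ "{p. p $ 3 > d}"])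
        (use 2 d in \<open>auto simp: field_def open_halfspace_component_gt_cart\<close>)
    then show ?thesis using 2 by (simp add: grad_def)
  next
    case 3
    have "grad p *v v = vector [t * v $ 2, - (t * v $ 1), - (t * X p / W p) * v $ 1 - t * Y p / W p * v $ 2]" for v
      using 3 by (simp add: vec_eq_iff forall_3 matrix_vector_mult_def sum_3 grad_def)
    moreover have "(field has_derivative (\<lambda>v. vector [t * v $ 2, - (t * v $ 1), - (t * X p / W p) * v $ 1 - t * Y p / W p * v $ 2])) (at p)"
    proof (rule has_derivative_transform_within_open[OF has_derivative_twist])
      show "open ({p :: real^3. p $ 3 > 0} \<inter> {p. p $ 3 < d})"
        by (intro open_Int open_halfspace_component_gt_cart open_halfspace_component_lt_cart)
    qed (use p 3 in \<open>auto simp: jump_planes_def field_def\<close>)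
    ultimately show ?thesis by simp
  qed
qed

lemma approx_gradient_field: "p \<notin> jump_planes \<Longrightarrow> approx_gradient field p = grad p"
  by (intro approx_gradient_eqI has_derivative_has_approx_derivative has_derivative_field eventually_integrable_field)

lemma approx_discontinuity_field: "approx_discontinuity_set U field \<subseteq> jump_planes"
  using has_derivative_has_approx_derivative[OF has_derivative_field]
  by (auto simp: approx_discontinuity_set_def has_approx_derivative_def)

section \<open>Genuine discontinuities of the field\<close>

lemma field_slab: "0 < p $ 3 \<Longrightarrow> p $ 3 < d \<Longrightarrow> field p = vector [Y p, - X p, W p]"
  by (simp add: field_def)

lemma component_diff_le: "\<bar>u $ i - v $ i\<bar> \<le> norm (u - v)" for u v :: "real^3"
  using component_le_norm_cart[of "u - v" i] by simp

text \<open>Absence of a Cantor part means that the singular measure charges only true discontinuity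
  points, so each point with nonzero \<open>jump\<close> must be detected. In each case a single
  component of the field separates the two sides of the plane, also at points where several planes
  meet.\<close>

lemma jump_no_approx_limit_field:
  assumes "jump p \<noteq> 0"
  shows "\<not> has_approx_limit field a p"
proof -
  consider (x) "0 < p $ 3" "p $ 3 < d" "p $ 1 \<in> kinks h1" | (y) "0 < p $ 3" "p $ 3 < d" "p $ 2 \<in> kinks h2"
    | (bot) "p $ 3 = 0" | (top) "p $ 3 = d" "X p \<noteq> 0 \<or> Y p \<noteq> 0"
  proof -
    have "jump p = 0" if "p $ 3 = d" "X p = 0" "Y p = 0"
      using that d by (simp add: jump_def vec_eq_iff forall_3 W_def)
    moreover have "jump p = 0" if "0 < p $ 3" "p $ 3 < d" "p $ 1 \<notin> kinks h1" "p $ 2 \<notin> kinks h2"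
      using that by (simp add: jump_def vec_eq_iff forall_3)
    moreover have "jump p = 0" if "p $ 3 < 0 \<or> p $ 3 > d"
      using that d by (auto simp: jump_def)
    ultimately show ?thesis
      using assms that by (metis linorder_neqE_linordered_idom)
  qed
  then show ?thesis
  proof cases
    case x
    show ?thesis
    proof (rule jump_no_approx_limit_axis[OF eventually_integrable_field, of "t * h1" "Min {h1, p $ 3, d - p $ 3}" _ 1])
      fix r :: real and y :: "real^3" assume r: "0 < r" "r < Min {h1, p $ 3, d - p $ 3}" "p $ 1 - r < y $ 1" "y $ 1 < p $ 1" "dist y p < r"
      have "\<bar>y $ 3 - p $ 3\<bar> < r" using component_diff_le[of y 3 p] r by (simp add: dist_norm)
      then have y3: "0 < y $ 3" "y $ 3 < d" using r by auto
      let ?y = "y + r *\<^sub>R axis 1 1"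
      have y': "?y $ 1 = y $ 1 + r" "?y $ 3 = y $ 3" by (simp_all add: axis_def)
      \<comment> \<open>The radius is kept below \<open>h1\<close>, so the gap
        \<open>2 * h1 - r\<close> stays above \<open>h1\<close>.\<close>
      have "t * h1 \<le> t * (2 * h1 - r)" using r t by (intro mult_left_mono) auto
      also have "\<dots> = X y - X ?y"
        using wrap_jump[OF h1 x(3), of r "y $ 1"] r by (simp only: X_def y' right_diff_distrib[symmetric]) simp
      also have "\<dots> = field ?y $ 2 - field y $ 2"
        using y3 by (simp add: field_slab y' del: vector_add_component)
      also have "\<dots> \<le> norm (field y - field ?y)"
        using component_diff_le[of "field y" 2 "field ?y"] by linarith
      finally show "t * h1 \<le> norm (field y - field ?y)" .
    qed (use x t h1 in auto)
  next
    case y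
    show ?thesis
    proof (rule jump_no_approx_limit_axis[OF eventually_integrable_field, of "t * h2" "Min {h2, p $ 3, d - p $ 3}" _ 2])
      fix r :: real and y :: "real^3" assume r: "0 < r" "r < Min {h2, p $ 3, d - p $ 3}" "p $ 2 - r < y $ 2" "y $ 2 < p $ 2" "dist y p < r"
      have "\<bar>y $ 3 - p $ 3\<bar> < r" using component_diff_le[of y 3 p] r by (simp add: dist_norm)
      then have y3: "0 < y $ 3" "y $ 3 < d" using r by auto
      let ?y = "y + r *\<^sub>R axis 2 1"
      have y': "?y $ 2 = y $ 2 + r" "?y $ 3 = y $ 3" by (simp_all add: axis_def)
      have "t * h2 \<le> t * (2 * h2 - r)" using r t by (intro mult_left_mono) auto
      also have "\<dots> = Y y - Y ?y"
        using wrap_jump[OF h2 \<open>p $ 2 \<in> kinks h2\<close>, of r "y $ 2"] r by (simp only: Y_def y' right_diff_distrib[symmetric]) simp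
      also have "\<dots> = field y $ 1 - field ?y $ 1"
        using y3 by (simp add: field_slab y' del: vector_add_component)
      also have "\<dots> \<le> norm (field y - field ?y)"
        using component_diff_le[of "field y" 1 "field ?y"] by linarith
      finally show "t * h2 \<le> norm (field y - field ?y)" .
    qed (use y t h2 in auto)
  next
    case bot
    show ?thesis
    proof (rule jump_no_approx_limit_axis[OF eventually_integrable_field, of "3 / 4" d _ 3])
      fix r :: real and y :: "real^3" assume r: "0 < r" "r < d" "p $ 3 - r < y $ 3" "y $ 3 < p $ 3"
      let ?y = "y + r *\<^sub>R axis 3 1"
      have y': "?y $ 3 = y $ 3 + r" by (simp add: axis_def)
      \<comment> \<open>Below the plane the first component is 1, above it at most 1/4; continuity
        of \<open>Y\<close> plays no part, so kinks are covered.\<close>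
      have "3 / 4 \<le> 1 - Y ?y" using Y_bound[of ?y] by linarith
      also have "\<dots> = field y $ 1 - field ?y $ 1"
      proof -
        have "field y = axis 1 1" "field ?y = vector [Y ?y, - X ?y, W ?y]"
          using r bot by (simp_all add: field_def y' del: vector_add_component)
        then show ?thesis by simp
      qed
      also have "\<dots> \<le> norm (field y - field ?y)"
        using component_diff_le[of "field y" 1 "field ?y"] by linarith
      finally show "3 / 4 \<le> norm (field y - field ?y)" .
    qed (use d in auto)
  next
    case top
    \<comment> \<open>\<open>X\<close> and \<open>Y\<close> jump at kinks, but their absolute values
      do not. Hence a component that is nonzero at \<open>p\<close> stays bounded away from 0 just
      below the top plane, even where vertical faces end.\<close>
    have cont: "continuous_on UNIV (\<lambda>p. \<bar>X p\<bar>)" "continuous_on UNIV (\<lambda>p. \<bar>Y p\<bar>)"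
      unfolding X_def Y_def abs_mult
      by (intro continuous_intros continuous_on_compose2[OF continuous_abs_wrap[of _ UNIV]] h1 h2; simp)+
    obtain f i where f: "continuous_on UNIV f" "f p > 0" "\<And>q. 0 < q $ 3 \<Longrightarrow> q $ 3 < d \<Longrightarrow> f q = \<bar>field q $ i\<bar>" "i \<noteq> 3"
    proof (cases "X p = 0")
      case False
      then show ?thesis
        using that[of "\<lambda>p. \<bar>X p\<bar>" 2] cont by (simp add: field_slab)
    next
      case True
      then show ?thesis
        using that[of "\<lambda>p. \<bar>Y p\<bar>" 1] cont top by (simp add: field_slab)
    qed
    obtain \<delta> where \<delta>: "\<delta> > 0" "\<And>y. dist y p < \<delta> \<Longrightarrow> dist (f y) (f p) < f p / 2"
      using f(1,2) unfolding continuous_on_iff by (metis UNIV_I half_gt_zero)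
    show ?thesis
    proof (rule jump_no_approx_limit_axis[OF eventually_integrable_field, of "f p / 2" "min d \<delta>" _ 3])
      fix r :: real and y :: "real^3" assume r: "0 < r" "r < min d \<delta>" "p $ 3 - r < y $ 3" "y $ 3 < p $ 3" "dist y p < r"
      let ?y = "y + r *\<^sub>R axis 3 1"
      have y': "?y $ 3 = y $ 3 + r" by (simp add: axis_def)
      have "dist y p < \<delta>" using r by simp
      then have "f p / 2 \<le> f y" using \<delta>(2)[of y] unfolding dist_real_def by linarith
      also have "\<dots> = \<bar>field y $ i\<bar>" using r top f(3)[of y] by simp
      also have "\<dots> = \<bar>field y $ i - field ?y $ i\<bar>"
      proof -
        have "field ?y = axis 3 1"
          using r top d by (simp add: field_def y' del: vector_add_component)
        then show ?thesis using f(4) by (simp add: axis_def)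
      qed
      also have "\<dots> \<le> norm (field y - field ?y)"
        by (rule component_diff_le)
      finally show "f p / 2 \<le> norm (field y - field ?y)" .
    qed (use d \<delta> f in auto)
  qed
qed

lemma jump_approx_discontinuity: "p \<in> U \<Longrightarrow> jump p \<noteq> 0 \<Longrightarrow> p \<in> approx_discontinuity_set U field"
  using jump_no_approx_limit_field by (simp add: approx_discontinuity_set_def)

section \<open>Gauss-Green formula with jumps\<close>

definition levels :: "real \<Rightarrow> 3 \<Rightarrow> real set" where
  "levels R k = (if k = 1 then kinks_upto h1 R else if k = 2 then kinks_upto h2 R else {0, d})"

text \<open>Whole planes are used although the vertical faces occupy only heights between 0 and
  \<open>d\<close>; \<open>jump\<close> vanishes on the vertical planes above and below.\<close>

definition planes :: "real \<Rightarrow> (3 \<times> real) set" where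
  "planes R = Sigma UNIV (levels R)"

lemma finite_levels: "finite (levels R k)"
  by (simp add: levels_def finite_kinks_upto)

lemma finite_planes: "finite (planes R)"
  unfolding planes_def by (intro finite_SigmaI finite_levels) auto

text \<open>Outside the slab the field is constant along the line. Inside it, component 1 is
  constant, component 2 a sawtooth and component 3 a continuous root. The identity holds on every
  line, without exceptional \<open>q\<close>.\<close>

lemma has_integral_by_parts_line1:
  fixes \<phi> \<phi>' :: "real \<Rightarrow> real"
  assumes R: "d < R" and \<phi>: "\<And>s. (\<phi> has_real_derivative \<phi>' s) (at s)" "\<And>s. s \<notin> {-R<..<R} \<Longrightarrow> \<phi> s = 0"
  shows "((\<lambda>s. field (slot 1 s q) $ i * \<phi>' s + \<phi> s * grad (slot 1 s q) $ i $ 1) has_integral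
    - (\<Sum>u\<in>levels R 1. jump (slot 1 u q) $ i $ 1 * \<phi> u)) {-R..R}"
proof (cases "0 < snd q \<and> snd q < d")
  case False
  have "jump (slot 1 u q) $ i $ 1 = 0" "grad (slot 1 u q) $ i $ 1 = 0" for u
    using False exhaust_3[of i] by (auto simp: jump_def grad_def slot_nth)
  moreover have "field (slot 1 u q) $ i = (if snd q \<le> 0 then axis 1 1 else axis 3 1) $ i" for u
    using False by (auto simp: field_def slot_nth)
  ultimately show ?thesis
    using has_integral_by_parts_const[OF _ \<phi>] R d by simp
next
  case True
  then have f: "field (slot 1 s q) = vector [Y (slot 1 s q), - X (slot 1 s q), W (slot 1 s q)]" for s
    by (intro field_slab) (simp_all add: slot_nth)
  have R0: "R > 0" using R d by simp
  consider "i = 1" | "i = 2" | "i = 3" using exhaust_3[of i] by blast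
  then show ?thesis
  proof cases
    case 1
    then show ?thesis
      using True has_integral_by_parts_const[OF R0 \<phi>, of "t * wrap h2 (fst q)"]
      by (simp add: f jump_def grad_def slot_nth Y_def)
  next
    case 2
    have "jump (slot 1 u q) $ i $ 1 = 2 * h1 * t" if "u \<in> levels R 1" for u
      using that True 2 kinks_upto_subset[of h1 R] by (auto simp: jump_def slot_nth levels_def)
    then show ?thesis
      using True 2 has_integral_by_parts_wrap[OF h1 R0 \<phi>, of "- t"]
      by (simp add: f grad_def slot_nth X_def levels_def)
  next
    case 3
    have pos: "0 < 1 - (Y (slot 1 0 q))\<^sup>2 - (t * wrap h1 s)\<^sup>2" for s
      using W_radicand_pos[of "slot 1 s q"] by (simp add: X_def Y_def slot_nth algebra_simps)
    show ?thesis
      using True 3 has_integral_by_parts_sqrt_wrap[OF h1 R0 \<phi> pos]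
      by (simp add: f grad_def jump_def slot_nth X_def Y_def W_def)
  qed
qed

lemma has_integral_by_parts_line2:
  fixes \<phi> \<phi>' :: "real \<Rightarrow> real"
  assumes R: "d < R" and \<phi>: "\<And>s. (\<phi> has_real_derivative \<phi>' s) (at s)" "\<And>s. s \<notin> {-R<..<R} \<Longrightarrow> \<phi> s = 0"
  shows "((\<lambda>s. field (slot 2 s q) $ i * \<phi>' s + \<phi> s * grad (slot 2 s q) $ i $ 2) has_integral
    - (\<Sum>u\<in>levels R 2. jump (slot 2 u q) $ i $ 2 * \<phi> u)) {-R..R}"
proof (cases "0 < snd q \<and> snd q < d")
  case False
  have "jump (slot 2 u q) $ i $ 2 = 0" "grad (slot 2 u q) $ i $ 2 = 0" for u
    using False exhaust_3[of i] by (auto simp: jump_def grad_def slot_nth)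
  moreover have "field (slot 2 u q) $ i = (if snd q \<le> 0 then axis 1 1 else axis 3 1) $ i" for u
    using False by (auto simp: field_def slot_nth)
  ultimately show ?thesis
    using has_integral_by_parts_const[OF _ \<phi>] R d by simp
next
  case True
  then have f: "field (slot 2 s q) = vector [Y (slot 2 s q), - X (slot 2 s q), W (slot 2 s q)]" for s
    by (intro field_slab) (simp_all add: slot_nth)
  have R0: "R > 0" using R d by simp
  consider "i = 1" | "i = 2" | "i = 3" using exhaust_3[of i] by blast
  then show ?thesis
  proof cases
    case 1
    have "jump (slot 2 u q) $ i $ 2 = - 2 * h2 * t" if "u \<in> levels R 2" for u
      using that True 1 kinks_upto_subset[of h2 R] by (auto simp: jump_def slot_nth levels_def)
    then show ?thesis
      using True 1 has_integral_by_parts_wrap[OF h2 R0 \<phi>, of t]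
      by (simp add: f grad_def slot_nth Y_def levels_def)
  next
    case 2
    then show ?thesis
      using True has_integral_by_parts_const[OF R0 \<phi>, of "- (t * wrap h1 (fst q))"]
      by (simp add: f jump_def grad_def slot_nth X_def)
  next
    case 3
    have pos: "0 < 1 - (X (slot 2 0 q))\<^sup>2 - (t * wrap h2 s)\<^sup>2" for s
      using W_radicand_pos[of "slot 2 s q"] by (simp add: X_def Y_def slot_nth algebra_simps)
    have W: "W (slot 2 s q) = sqrt (1 - (X (slot 2 0 q))\<^sup>2 - (t * wrap h2 s)\<^sup>2)" for s
      by (simp add: W_def X_def Y_def slot_nth algebra_simps)
    show ?thesis
      using True 3 has_integral_by_parts_sqrt_wrap[OF h2 R0 \<phi> pos]
      by (simp add: f grad_def jump_def slot_nth W Y_def)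
  qed
qed

lemma has_integral_by_parts_line3:
  fixes \<phi> \<phi>' :: "real \<Rightarrow> real"
  assumes R: "d < R" and \<phi>: "\<And>s. (\<phi> has_real_derivative \<phi>' s) (at s)" "\<And>s. s \<notin> {-R<..<R} \<Longrightarrow> \<phi> s = 0"
  shows "((\<lambda>s. field (slot 3 s q) $ i * \<phi>' s + \<phi> s * grad (slot 3 s q) $ i $ 3) has_integral
    - (\<Sum>u\<in>levels R 3. jump (slot 3 u q) $ i $ 3 * \<phi> u)) {-R..R}"
proof -
  let ?b = "vector [Y (slot 3 0 q), - X (slot 3 0 q), W (slot 3 0 q)] :: real^3"
  have XYW: "X (slot 3 s q) = X (slot 3 0 q)" "Y (slot 3 s q) = Y (slot 3 0 q)" "W (slot 3 s q) = W (slot 3 0 q)" for s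
    by (simp_all add: X_def Y_def W_def slot_nth)
  have f: "field (slot 3 s q) $ i = (if s \<le> 0 then axis 1 1 $ i else if d \<le> s then axis 3 1 $ i else ?b $ i)" for s
    by (simp add: field_def slot_nth XYW[of s])
  have g: "grad (slot 3 s q) $ i $ 3 = 0" for s
    using exhaust_3[of i] by (auto simp: grad_def)
  have j: "jump (slot 3 0 q) $ i $ 3 = ?b $ i - axis 1 1 $ i" "jump (slot 3 d q) $ i $ 3 = axis 3 1 $ i - ?b $ i"
    using exhaust_3[of i] d by (auto simp: jump_def slot_nth XYW[of d] axis_def)
  show ?thesis
    using has_integral_by_parts_slab[OF d R \<phi>, of "axis 1 1 $ i" "axis 3 1 $ i" "?b $ i"] d
    by (simp add: f g j levels_def)
qed

lemma has_integral_by_parts_line: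
  fixes \<phi> \<phi>' :: "real \<Rightarrow> real"
  assumes "d < R" "\<And>s. (\<phi> has_real_derivative \<phi>' s) (at s)" "\<And>s. s \<notin> {-R<..<R} \<Longrightarrow> \<phi> s = 0"
  shows "((\<lambda>s. field (slot k s q) $ i * \<phi>' s + \<phi> s * grad (slot k s q) $ i $ k) has_integral
    - (\<Sum>u\<in>levels R k. jump (slot k u q) $ i $ k * \<phi> u)) {-R..R}"
  using exhaust_3[of k] has_integral_by_parts_line1[OF assms, of q i] has_integral_by_parts_line2[OF assms, of q i]
    has_integral_by_parts_line3[OF assms, of q i] by auto

lemma norm_jump: "norm (jump p) \<le> 2"
proof (rule power2_le_imp_le)
  have "(2 * (t * h1))\<^sup>2 \<le> 1" "(2 * (t * h2))\<^sup>2 \<le> 1"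
    unfolding abs_square_le_1 using th1 th2 mult_pos_pos[OF t h1] mult_pos_pos[OF t h2] by linarith+
  then have "(2 * h1 * t)\<^sup>2 \<le> 1" "(2 * h2 * t)\<^sup>2 \<le> 1"
    by (simp_all add: mult_ac)
  moreover have "(Y p - 1)\<^sup>2 \<le> (5 / 4)\<^sup>2"
    using Y_bound[of p] by (intro abs_le_square_iff[THEN iffD1]) linarith
  moreover have "(W p)\<^sup>2 \<le> 1" "(1 - W p)\<^sup>2 \<le> 1"
    using W_lower[of p] W_upper[of p] by (simp_all add: abs_square_le_1)
  ultimately show "(norm (jump p))\<^sup>2 \<le> 2\<^sup>2"
    using X2_bound[of p] Y2_bound[of p]
    by (auto simp: jump_def power2_norm_matrix3 power_divide)
qed simp

text \<open>On a plane with normal \<open>k\<close> only column \<open>k\<close> of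
  \<open>jump\<close> is nonzero, except on the intersections with other planes, where
  \<open>jump\<close> may also record their jumps. The excluded values of \<open>q\<close> remove
  these intersections.\<close>

lemma jump_off_direction:
  assumes "k \<noteq> j" "fst q \<notin> kinks h1 \<union> kinks h2 \<union> {0, d}" "snd q \<notin> kinks h1 \<union> kinks h2 \<union> {0, d}" "u \<in> levels R k"
  shows "jump (slot k u q) $ i $ j = 0"
proof -
  have "u = 0 \<or> u = d" if "k = 3" using assms(4) that by (auto simp: levels_def)
  then show ?thesis
    using assms exhaust_3[of k] exhaust_3[of j] exhaust_3[of i] d by (auto simp: jump_def slot_nth)
qed

text \<open>Fubini reduces the formula in direction \<open>j\<close> to the lines parallel to axis
  \<open>j\<close>, which produce only the planes normal to that axis. The remaining planes are
  added afterwards at no cost.\<close>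

lemma gauss_green_field:
  assumes U: "open U" "U \<subseteq> {p. \<forall>k. \<bar>p $ k\<bar> < R}" and R: "d < R"
    and \<phi>: "test_function U \<phi> D\<phi>"
  shows "(LINT x:U|lebesgue. field x $ i * D\<phi> x $ j)
        = - ((LINT x:U|lebesgue. \<phi> x * grad x $ i $ j) + (LINT x|planes_measure (planes R). \<phi> x * jump x $ i $ j))"
proof -
  let ?F = "\<lambda>x. field x $ i * D\<phi> x $ j" and ?G = "\<lambda>x. \<phi> x * grad x $ i $ j" and ?J = "\<lambda>x. \<phi> x * jump x $ i $ j"
  have der: "(\<phi> has_derivative (\<lambda>h. D\<phi> x \<bullet> h)) (at x)" and cD: "continuous_on UNIV D\<phi>" for x
    using \<phi> by (auto simp: test_function_def)
  have c\<phi>: "continuous_on UNIV \<phi>"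
    using der by (meson continuous_at_imp_continuous_on has_derivative_continuous)
  have [measurable]: "\<phi> \<in> borel_measurable borel" "D\<phi> \<in> borel_measurable borel"
    using c\<phi> cD by (auto intro: borel_measurable_continuous_onI)
  note zero = test_function_zero[OF \<phi>]
  obtain B where B: "\<And>x. \<bar>\<phi> x\<bar> \<le> B" "\<And>x. norm (D\<phi> x) \<le> B"
    using test_function_bounded[OF \<phi>] by blast
  have B0: "B \<ge> 0" using B(1)[of 0] by linarith
  have bU: "bounded U"
  proof (rule bounded_subset)
    show "U \<subseteq> cbox (\<chi> k. - R) (\<chi> k. R)"
      using U(2) by (auto simp: mem_box_cart abs_less_iff less_imp_le dest!: subsetD) (smt (verit))+
  qed simp
  let ?C = "2 :: real"
  have bF: "norm (?F x) \<le> 1 * B" and bG: "norm (?G x) \<le> B * (2 * t)" and bJ: "norm (?J x) \<le> B * ?C" for x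
  proof -
    have comp: "\<bar>A $ i $ j\<bar> \<le> norm A" for A :: "real^3^3"
      using component_le_norm_cart[of "A $ i" j] Finite_Cartesian_Product.norm_nth_le[of A i] by linarith
    show "norm (?F x) \<le> 1 * B" "norm (?G x) \<le> B * (2 * t)" "norm (?J x) \<le> B * ?C"
      unfolding real_norm_def abs_mult
      using B[of x] component_le_norm_cart[of "field x" i] component_le_norm_cart[of "D\<phi> x" j] norm_field[of x]
        comp[of "grad x"] comp[of "jump x"] norm_grad[of x] norm_jump[of x] B0
      by (intro mult_mono; linarith)+
  qed
  have intF: "integrable lborel ?F"
    by (rule integrable_lborel_bounded[OF _ bF bU]) (simp_all add: zero)
  have intG: "integrable lborel ?G"
    by (rule integrable_lborel_bounded[OF _ bG bU]) (simp_all add: zero)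
  \<comment> \<open>All integrands vanish off \<open>U\<close> together with the test function, so
    set integrals become integrals over the whole space, where Fubini applies.\<close>
  have set: "(LINT x:U|lebesgue. h x) = (LINT x|lborel. h x)"
    if "h \<in> borel_measurable borel" "\<And>x. x \<notin> U \<Longrightarrow> h x = 0" for h :: "real^3 \<Rightarrow> real"
  proof -
    have "(\<lambda>x. indicator U x *\<^sub>R h x) = h"
    proof
      show "indicator U x *\<^sub>R h x = h x" for x
        using that(2) by (cases "x \<in> U") simp_all
    qed
    then show ?thesis
      using that(1) by (simp add: set_lebesgue_integral_def integral_completion)
  qed
  have line: "(LINT s|lborel. ?F (slot j s q) + ?G (slot j s q)) = - (\<Sum>u\<in>levels R j. ?J (slot j u q))" for q
  proof -
    have slotU: "slot j s q \<notin> U" if "s \<notin> {-R<..<R}" for s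
    proof
      assume "slot j s q \<in> U"
      then have "\<bar>slot j s q $ j\<bar> < R" using U(2) by blast
      then show False using that by (auto simp: slot_nth_same abs_less_iff)
    qed
    have d1: "((\<lambda>s. \<phi> (slot j s q)) has_real_derivative D\<phi> (slot j s q) $ j) (at s)" for s
    proof -
      have "((\<lambda>s. slot j s q) has_derivative (\<lambda>s. s *\<^sub>R axis j 1)) (at s)"
        unfolding slot_def by (auto intro!: derivative_eq_intros)
      from has_derivative_compose[OF this der] show ?thesis
        by (simp add: has_field_derivative_def inner_axis mult_commute_abs)
    qed
    have "((\<lambda>s. ?F (slot j s q) + ?G (slot j s q)) has_integral - (\<Sum>u\<in>levels R j. jump (slot j u q) $ i $ j * \<phi> (slot j u q))) {-R..R}"
      by (rule has_integral_by_parts_line[OF R d1]) (simp add: zero slotU)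
    then have "((\<lambda>s. ?F (slot j s q) + ?G (slot j s q)) has_integral - (\<Sum>u\<in>levels R j. ?J (slot j u q))) {-R..R}"
      by (simp only: mult.commute[of "jump _ $ i $ j"])
    then have "((\<lambda>s. ?F (slot j s q) + ?G (slot j s q)) has_integral - (\<Sum>u\<in>levels R j. ?J (slot j u q))) UNIV"
    proof (rule has_integral_on_superset)
      show "?F (slot j s q) + ?G (slot j s q) = 0" if "s \<notin> {-R..R}" for s
      proof -
        have "slot j s q \<notin> U" using slotU[of s] that by auto
        then show ?thesis using zero[of "slot j s q"] by simp
      qed
    qed simp
    moreover have "integrable lborel (\<lambda>s. ?F (slot j s q) + ?G (slot j s q))"
    proof (rule integrable_lborel_bounded[of _ "1 * B + B * (2 * t)" "{-R..R}"])
      show "norm (?F (slot j s q) + ?G (slot j s q)) \<le> 1 * B + B * (2 * t)" for s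
        using norm_triangle_ineq[of "?F (slot j s q)" "?G (slot j s q)"] bF[of "slot j s q"] bG[of "slot j s q"] by linarith
      show "(\<lambda>s. ?F (slot j s q) + ?G (slot j s q)) \<in> borel_measurable borel"
        by measurable
    qed (use slotU zero in auto)
    ultimately show ?thesis
      \<comment> \<open>The fundamental theorem gives a gauge integral; boundedness and bounded
        support identify it with the Lebesgue integral.\<close>
      using has_integral_integral_lborel has_integral_unique by blast
  qed
  have intJ: "integrable lborel (\<lambda>q. ?J (slot k u q))" for k u
    by (rule integrable_slot[OF _ bJ bU]) (simp_all add: zero)
  have "(LINT x|lborel. ?F x) + (LINT x|lborel. ?G x) = (LINT x|lborel. ?F x + ?G x)"
    using intF intG by simp
  also have "\<dots> = (LINT q|lborel. LINT s|lborel. ?F (slot j s q) + ?G (slot j s q))"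
    by (rule integral_slot) (use intF intG in simp)
  also have "\<dots> = - (\<Sum>u\<in>levels R j. LINT q|lborel. ?J (slot j u q))"
    unfolding line by (simp add: Bochner_Integration.integral_sum[OF intJ])
  also have "(\<Sum>u\<in>levels R j. LINT q|lborel. ?J (slot j u q)) = (\<Sum>k\<in>UNIV. \<Sum>u\<in>levels R k. LINT q|lborel. ?J (slot k u q))"
  proof (subst sum.remove[of UNIV j])
    \<comment> \<open>Column \<open>j\<close> of the jump on a plane of another direction is
      supported on lines, which are null for the area.\<close>
    have "(LINT q|lborel. ?J (slot k u q)) = 0" if k: "k \<noteq> j" "u \<in> levels R k" for k u
    proof (rule integral_eq_zero_AE)
      have "countable (kinks h1 \<union> kinks h2 \<union> {0, d})"
        by (simp add: countable_kinks)
      from AE_lborel_pair_notin_countable[OF this] show "AE q in lborel. ?J (slot k u q) = 0"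
        by eventually_elim (use jump_off_direction[OF k(1) _ _ k(2)] in simp)
    qed
    then show "(\<Sum>u\<in>levels R j. LINT q|lborel. ?J (slot j u q)) = (\<Sum>u\<in>levels R j. LINT q|lborel. ?J (slot j u q))
        + (\<Sum>k\<in>UNIV - {j}. \<Sum>u\<in>levels R k. LINT q|lborel. ?J (slot k u q))"
      by simp
  qed auto
  also have "\<dots> = (LINT x|planes_measure (planes R). ?J x)"
    unfolding planes_def
    by (subst integral_planes_measure[OF _ _ bJ bU])
       (auto simp: zero sum.Sigma finite_levels finite_planes[unfolded planes_def])
  finally show ?thesis
    by (simp add: set zero)
qed

section \<open>Area of the jump set\<close>

lemma jump_planes_levels:
  assumes p: "p \<in> jump_planes" and R: "R > 0" "\<And>k. \<bar>p $ k\<bar> < R"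
  shows "\<exists>k. p $ k \<in> levels R k"
proof -
  have "p $ 1 \<in> kinks h1 \<Longrightarrow> p $ 1 \<in> levels R 1" "p $ 2 \<in> kinks h2 \<Longrightarrow> p $ 2 \<in> levels R 2"
    using kinks_in_kinks_upto[OF h1 R(1)] kinks_in_kinks_upto[OF h2 R(1)] R(2) by (auto simp: levels_def)
  moreover have "p $ 3 \<in> {0, d} \<Longrightarrow> p $ 3 \<in> levels R 3" by (simp add: levels_def)
  ultimately show ?thesis
    using p unfolding jump_planes_def by blast
qed

text \<open>The 10 collects 4 from each of the two kink counts and 2 horizontal planes.\<close>

lemma card_planes:
  assumes "R > 0"
  shows "real (card (planes R)) \<le> 2 * R / h1 + 2 * R / h2 + 10"
proof -
  have "card (planes R) = card (kinks_upto h1 R) + card (kinks_upto h2 R) + card {0, d}"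
    unfolding planes_def by (subst card_SigmaI) (simp_all add: finite_levels, simp add: sum_3 levels_def)
  then have "real (card (planes R)) = real (card (kinks_upto h1 R)) + real (card (kinks_upto h2 R)) + 2"
    using d by simp
  then show ?thesis
    using card_kinks_upto[OF h1 assms] card_kinks_upto[OF h2 assms] by linarith
qed

lemma hausdorff_jump_planes:
  assumes S: "S \<subseteq> jump_planes" "S \<subseteq> {p. \<forall>k. \<bar>p $ k\<bar> < R}" and R: "R > 0"
  shows "hausdorff_measure 2 S \<le> ennreal ((2 * R / h1 + 2 * R / h2 + 10) * (16 * pi * R\<^sup>2))"
proof -
  have "hausdorff_measure 2 S \<le> ennreal (real (card (planes R)) * (16 * pi * R\<^sup>2))"
  proof (rule hausdorff_measure_2_le[where f = "\<lambda>(k, s). slot k s"])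
    show "S \<subseteq> (\<Union>i\<in>planes R. (case i of (k, s) \<Rightarrow> slot k s) ` ({-R..R} \<times> {-R..R}))"
    proof
      fix p assume p: "p \<in> S"
      then have b: "\<bar>p $ k\<bar> < R" for k using S(2) by blast
      obtain k where k: "p $ k \<in> levels R k"
        using jump_planes_levels[of p R] S(1) p b R by blast
      obtain q where q: "p = slot k (p $ k) q" using slot_surj by blast
      have "\<bar>fst q\<bar> < R \<and> \<bar>snd q\<bar> < R"
        using b[of 1] b[of 2] b[of 3] exhaust_3[of k] by (subst (asm) (1 2 3) q) (auto simp: slot_nth)
      then have "q \<in> {-R..R} \<times> {-R..R}"
        unfolding mem_Icc_Times_iff by simp
      then show "p \<in> (\<Union>i\<in>planes R. (case i of (k, s) \<Rightarrow> slot k s) ` ({-R..R} \<times> {-R..R}))"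
        using k q by (intro UN_I[of "(k, p $ k)"]) (auto simp: planes_def)
    qed
  qed (use R in \<open>auto simp: finite_planes dist_slot\<close>)
  also have "\<dots> \<le> ennreal ((2 * R / h1 + 2 * R / h2 + 10) * (16 * pi * R\<^sup>2))"
    using card_planes[OF R] by (intro ennreal_leI mult_right_mono) auto
  finally show ?thesis .
qed

section \<open>Admissibility of the field\<close>

lemma abs_integrable_grad:
  assumes "U \<in> sets borel" "bounded U"
  shows "grad absolutely_integrable_on U"
proof -
  have "integrable lborel (\<lambda>p. indicator U p *\<^sub>R grad p)"
    using assms t by (intro integrable_lborel_bounded[where B = "2 * t" and A = U])
      (auto simp: norm_grad indicator_def)
  then show ?thesis
    unfolding set_integrable_def by (rule integrable_completion[THEN iffD2, rotated]) (use assms in auto)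
qed

lemma approx_gradient_field_off: "p \<in> U - jump_planes \<Longrightarrow> approx_gradient field p = grad p"
  by (simp add: approx_gradient_field)

lemma field_SBV2:
  assumes U: "open U" "bounded U"
  shows "field \<in> SBV2 U"
proof -
  obtain B where B: "\<And>p. p \<in> U \<Longrightarrow> norm p \<le> B"
    using U(2) unfolding bounded_iff by blast
  \<comment> \<open>The cube of half-width \<open>R\<close> must contain \<open>U\<close>, and
    \<open>R\<close> must exceed \<open>d\<close> so that lines in direction 3 cross both horizontal
    planes.\<close>
  define R where "R = max B d + 1"
  have R: "d < R" "R > 0" using d by (simp_all add: R_def)
  have UR: "U \<subseteq> {p. \<forall>k. \<bar>p $ k\<bar> < R}"
  proof (intro subsetI CollectI allI)
    show "\<bar>p $ k\<bar> < R" if "p \<in> U" for p k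
      using B[OF that] component_le_norm_cart[of p k] unfolding R_def by linarith
  qed
  have Ub: "U \<in> sets borel" using U by simp
  \<comment> \<open>Larger than \<open>jump_planes\<close>, because the plane measure charges whole
    planes and not just their part inside the slab.\<close>
  let ?N = "{p :: real^3. p $ 1 \<in> kinks h1 \<or> p $ 2 \<in> kinks h2 \<or> p $ 3 \<in> {0, d}}"
  have N: "?N \<in> sets borel" by measurable
  have Nnull: "?N \<in> null_sets lborel"
    using negligible_kink_planes N by (simp add: negligible_iff_null_sets null_sets_completion_iff)
  have "\<exists>\<mu> \<sigma>. derivative_decomposition U field grad \<mu> \<sigma> \<and> (AE x in \<mu>. x \<in> approx_discontinuity_set U field)"
  proof (rule derivative_decomposition_polar[where \<nu> = "planes_measure (planes R)" and J = jump])
    show "integrable (planes_measure (planes R)) (\<lambda>x. indicator U x * norm (jump x))"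
      using norm_jump U(2) Ub
      by (intro integrable_planes_measure[OF finite_planes, where B = 2 and A = U]) (auto simp: indicator_def)
    show "emeasure (planes_measure (planes R)) (- ?N) = 0"
      using kinks_upto_subset[of h1 R] kinks_upto_subset[of h2 R]
      by (intro emeasure_planes_measure_Compl finite_planes N)
         (auto simp: planes_def levels_def slot_nth split: if_splits; metis exhaust_3 slot_nth insertCI)
    show "sets (planes_measure (planes R)) = sets borel"
      by (simp add: planes_measure_def)
    show "(LINT x:U|lebesgue. field x $ i * D\<phi> x $ j)
        = - ((LINT x:U|lebesgue. \<phi> x * grad x $ i $ j) + (LINT x|planes_measure (planes R). \<phi> x * jump x $ i $ j))"
      if "test_function U \<phi> D\<phi>" for \<phi> D\<phi> i j
      by (rule gauss_green_field[OF U(1) UR R(1) that])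
  qed (use Ub Nnull U in \<open>auto intro: abs_integrable_grad jump_approx_discontinuity\<close>)
  then have "field \<in> SBV U"
    using abs_integrable_field[OF Ub U(2)] by (auto simp: SBV_def)
  \<comment> \<open>The approximate gradient is known only off a null set; its measurability is
    inherited from \<open>grad\<close> by completeness of Lebesgue measure.\<close>
  moreover have "approx_gradient field absolutely_integrable_on U"
    by (rule absolutely_integrable_spike[OF abs_integrable_grad[OF Ub U(2)] negligible_jump_planes approx_gradient_field_off])
  then have "set_borel_measurable lebesgue U (approx_gradient field)"
    unfolding set_integrable_def set_borel_measurable_def by (rule borel_measurable_integrable)
  moreover have "set_integrable lebesgue U (\<lambda>x. (norm (approx_gradient field x))\<^sup>2)"
  proof (rule absolutely_integrable_spike[OF _ negligible_jump_planes])
    have "integrable lborel (\<lambda>p. indicator U p *\<^sub>R (norm (grad p))\<^sup>2)"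
    proof (rule integrable_lborel_bounded[where B = "(2 * t)\<^sup>2" and A = U])
      show "(\<lambda>p. indicator U p *\<^sub>R (norm (grad p))\<^sup>2) \<in> borel_measurable borel"
        using Ub by measurable
      show "norm (indicator U p *\<^sub>R (norm (grad p))\<^sup>2) \<le> (2 * t)\<^sup>2" for p
        using power_mono[OF norm_grad[of p] norm_ge_zero, of 2] by (simp add: indicator_def)
    qed (use U in auto)
    then show "(\<lambda>p. (norm (grad p))\<^sup>2) absolutely_integrable_on U"
      unfolding set_integrable_def by (rule integrable_completion[THEN iffD2, rotated]) (use Ub in measurable)
  qed (simp add: approx_gradient_field)
  moreover have "hausdorff_measure 2 (approx_discontinuity_set U field) < \<infinity>"
    by (rule le_less_trans[OF hausdorff_jump_planes[OF approx_discontinuity_field _ R(2)]])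
       (use UR in \<open>auto simp: approx_discontinuity_set_def\<close>)
  ultimately show ?thesis
    by (simp add: SBV2_def)
qed

lemma extend_field:
  assumes "L1 = real k1 * h1" "L2 = real k2 * h2"
  shows "extend L1 L2 d field = field"
proof
  show "extend L1 L2 d field p = field p" for p
    unfolding assms by (simp add: extend_def field_def X_def Y_def W_def wrap_wrap_multiple h1 h2)
qed

lemma field_admissible:
  assumes "L1 = real k1 * h1" "L2 = real k2 * h2"
  shows "field \<in> admissible L1 L2 d \<epsilon>"
  using field_SBV2 open_Omega bounded_Omega by (auto simp: admissible_def extend_field[OF assms] norm_field)

section \<open>Energy of the competitor\<close>

lemma energy_density_field:
  assumes "0 < p $ 3" "p $ 3 < d"
  shows "(norm (grad p))\<^sup>2 + 2 * t * (field p \<bullet> curl_of_gradient (grad p)) + t\<^sup>2 * (norm (field p))\<^sup>2 \<le> - (t\<^sup>2 / 4)"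
proof -
  let ?S = "(X p)\<^sup>2 + (Y p)\<^sup>2"
  have W0: "W p > 0" using W_lower[of p] by linarith
  have "(norm (grad p))\<^sup>2 + 2 * t * (field p \<bullet> curl_of_gradient (grad p)) + t\<^sup>2 * (norm (field p))\<^sup>2
    = t\<^sup>2 * (3 + ?S / (W p)\<^sup>2 - 2 * ?S / W p - 4 * W p)"
    unfolding norm_field using assms W0
    by (simp add: grad_def field_slab power2_norm_matrix3 inner_curl_of_gradient)
       (simp add: field_simps power2_eq_square)
  also have "\<dots> \<le> t\<^sup>2 * (- (1 / 4))"
  proof (rule mult_left_mono)
    have "?S / (W p)\<^sup>2 \<le> 1 / 4"
    proof -
      have "(81 / 100 :: real) \<le> (W p)\<^sup>2"
        using power_mono[OF W_lower[of p], of 2] by (simp add: power2_eq_square)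
      then have "?S \<le> 1 / 4 * (W p)\<^sup>2"
        using X2_bound[of p] Y2_bound[of p] by linarith
      then show ?thesis using W0 by (simp add: field_simps)
    qed
    moreover have "0 \<le> 2 * ?S / W p" using W0 by simp
    \<comment> \<open>Discarding the nonpositive term leaves at most 3 + 1/4 - 4 * 9/10 = -7/20,
      which is below -1/4.\<close>
    ultimately show "3 + ?S / (W p)\<^sup>2 - 2 * ?S / W p - 4 * W p \<le> - (1 / 4)"
      using W_lower[of p] by linarith
  qed simp
  finally show ?thesis by simp
qed

lemma bulk_energy_field:
  "(LINT p:Omega L1 L2 d|lebesgue. (norm (approx_gradient field p))\<^sup>2
      + 2 * t * (field p \<bullet> curl_of_gradient (approx_gradient field p)) + t\<^sup>2 * (norm (field p))\<^sup>2)
   \<le> - (t\<^sup>2 / 4) * measure lebesgue (Omega L1 L2 d)"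
proof -
  let ?O = "Omega L1 L2 d"
  let ?e = "\<lambda>A p. (norm A)\<^sup>2 + 2 * t * (field p \<bullet> curl_of_gradient A) + t\<^sup>2 * (norm (field p))\<^sup>2"
  have O: "?O \<in> sets borel" "bounded ?O" "?O \<in> lmeasurable"
    using open_Omega bounded_Omega by (auto intro: lmeasurable_open)
  have [measurable]: "(\<lambda>p. curl_of_gradient (grad p)) \<in> borel_measurable borel"
    unfolding curl_of_gradient_def by measurable
  \<comment> \<open>Here integrability cannot be bypassed: with a non-integrable density the
    integral would be 0 and the negative upper bound would fail.\<close>
  have bound: "\<bar>?e (grad p) p\<bar> \<le> (2 * t)\<^sup>2 + 2 * t * (6 * (2 * t)) + t\<^sup>2" for p
  proof -
    have g: "\<bar>grad p $ i $ j\<bar> \<le> 2 * t" for i j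
      using component_le_norm_cart[of "grad p $ i" j] Finite_Cartesian_Product.norm_nth_le[of "grad p" i] norm_grad[of p]
      by linarith
    then have c: "\<bar>grad p $ i $ j - grad p $ j $ i\<bar> \<le> 4 * t" for i j
      using g[of i j] g[of j i] by linarith
    have "\<bar>field p $ i\<bar> \<le> 1" for i
      using component_le_norm_cart[of "field p" i] norm_field[of p] by simp
    then have fc: "\<bar>field p $ k * (grad p $ i $ j - grad p $ j $ i)\<bar> \<le> 1 * (4 * t)" for i j k
      unfolding abs_mult using c by (intro mult_mono) auto
    then have "\<bar>field p \<bullet> curl_of_gradient (grad p)\<bar> \<le> 6 * (2 * t)"
      unfolding inner_curl_of_gradient using fc[of 1 3 2] fc[of 2 1 3] fc[of 3 2 1] by linarith
    then have "\<bar>2 * t * (field p \<bullet> curl_of_gradient (grad p))\<bar> \<le> 2 * t * (6 * (2 * t))"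
      using t by (simp add: abs_mult)
    moreover have "(norm (grad p))\<^sup>2 \<le> (2 * t)\<^sup>2"
      by (intro power_mono norm_grad) simp
    ultimately show ?thesis
      using zero_le_power2[of "norm (grad p)"] zero_le_power2[of t]
      unfolding norm_field power_one mult_1_right by linarith
  qed
  have "integrable lborel (\<lambda>p. indicator ?O p *\<^sub>R ?e (grad p) p)"
    using O bound t
    by (intro integrable_lborel_bounded[where B = "(2 * t)\<^sup>2 + 2 * t * (6 * (2 * t)) + t\<^sup>2" and A = ?O])
       (auto simp: indicator_def intro!: add_nonneg_nonneg)
  then have "(\<lambda>p. ?e (grad p) p) absolutely_integrable_on ?O"
    unfolding set_integrable_def by (rule integrable_completion[THEN iffD2, rotated]) (use O in measurable)
  then have int: "(\<lambda>p. ?e (approx_gradient field p) p) absolutely_integrable_on ?O"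
    by (rule absolutely_integrable_spike[OF _ negligible_jump_planes]) (simp add: approx_gradient_field)
  have "(LINT p:?O|lebesgue. ?e (approx_gradient field p) p) \<le> (LINT p:?O|lebesgue. - (t\<^sup>2 / 4))"
    unfolding set_lebesgue_integral_def
  proof (rule integral_mono_AE)
    show "integrable lebesgue (\<lambda>p. indicator ?O p *\<^sub>R ?e (approx_gradient field p) p)"
      using int by (simp only: set_integrable_def)
    show "integrable lebesgue (\<lambda>p. indicat_real ?O p *\<^sub>R - (t\<^sup>2 / 4))"
      using absolutely_integrable_on_const[OF O(3)] by (simp only: set_integrable_def)
    have "AE p in lebesgue. p \<notin> jump_planes"
      using negligible_jump_planes by (intro AE_not_in) (simp add: negligible_iff_null_sets)
    then show "AE p in lebesgue. indicator ?O p *\<^sub>R ?e (approx_gradient field p) p \<le> indicat_real ?O p *\<^sub>R - (t\<^sup>2 / 4)"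
    proof eventually_elim
      case (elim p)
      show ?case
      proof (cases "p \<in> ?O")
        case True
        then have "0 < p $ 3" "p $ 3 < d" by (auto simp: Omega_def)
        then show ?thesis
          using energy_density_field[of p] True by (simp add: approx_gradient_field[OF elim])
      qed simp
    qed
  qed
  also have "\<dots> = - (t\<^sup>2 / 4) * measure lebesgue ?O"
    using O(3) by (simp add: set_lebesgue_integral_def fmeasurable_def mult.commute less_top[symmetric])
  finally show ?thesis .
qed

lemma energy_field_le:
  assumes L: "L1 = real k1 * h1" "L2 = real k2 * h2" "L1 > 0" "L2 > 0" and K: "K > 0"
    and R: "R = L1 + L2 + d"
  shows "energy L1 L2 d \<epsilon> K t field \<le> - (t\<^sup>2 / 4) * measure lebesgue (Omega L1 L2 d)
    + K * ((2 * R / h1 + 2 * R / h2 + 10) * (16 * pi * R\<^sup>2))"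
proof -
  have R0: "R > 0" using L d R by simp
  let ?J = "jump_set L1 L2 d \<epsilon> field"
  have "hausdorff_measure 2 ?J \<le> ennreal ((2 * R / h1 + 2 * R / h2 + 10) * (16 * pi * R\<^sup>2))"
  proof (rule hausdorff_jump_planes[OF _ _ R0])
    show J: "?J \<subseteq> jump_planes"
      using approx_discontinuity_field unfolding jump_set_def extend_field[OF L(1,2)] by blast
    \<comment> \<open>\<open>jump_planes\<close> has heights between 0 and \<open>d\<close> only, so
      the layers added outside the domain contribute no jumps, and \<open>R = L1 + L2 + d\<close>
      bounds the period cell for every \<open>\<epsilon>\<close>.\<close>
    show "?J \<subseteq> {p. \<forall>k. \<bar>p $ k\<bar> < R}"
    proof
      fix p assume p: "p \<in> ?J"
      then have "0 \<le> p $ 3" "p $ 3 \<le> d" using J d by (auto simp: jump_planes_def)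
      moreover have "- L1 \<le> p $ 1" "p $ 1 < L1" "- L2 \<le> p $ 2" "p $ 2 < L2"
        using p by (auto simp: jump_set_def)
      ultimately have "\<bar>p $ 1\<bar> < R" "\<bar>p $ 2\<bar> < R" "\<bar>p $ 3\<bar> < R"
        using L(3,4) d unfolding R by linarith+
      then show "p \<in> {p. \<forall>k. \<bar>p $ k\<bar> < R}" by (simp add: forall_3)
    qed
  qed
  then have "enn2real (hausdorff_measure 2 ?J) \<le> (2 * R / h1 + 2 * R / h2 + 10) * (16 * pi * R\<^sup>2)"
    using R0 h1 h2 by (intro enn2real_leI) auto
  then have "K * enn2real (hausdorff_measure 2 ?J) \<le> K * ((2 * R / h1 + 2 * R / h2 + 10) * (16 * pi * R\<^sup>2))"
    using K by (intro mult_left_mono) auto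
  then show ?thesis
    unfolding energy_def using bulk_energy_field[of L1 L2] by linarith
qed

end

section \<open>Choice of the threshold\<close>

lemma measure_Omega_pos:
  assumes "L1 > 0" "L2 > 0" "d > 0"
  shows "measure lebesgue (Omega L1 L2 d) > 0"
proof -
  have "vector [0, 0, d / 2] \<in> Omega L1 L2 d"
    using assms by (simp add: Omega_def)
  then have "\<not> negligible (Omega L1 L2 d)"
    using open_not_negligible[OF open_Omega] by blast
  moreover have "Omega L1 L2 d \<in> lmeasurable"
    unfolding Omega_eq_box by simp
  ultimately show ?thesis
    by (simp add: negligible_iff_measure zero_less_measure_iff)
qed

lemma exists_admissible_energy_neg:
  assumes L: "L1 > 0" "L2 > 0" and d: "d > 0" and K: "K > 0"
  shows "\<exists>tbar>0. \<forall>t>tbar. \<exists>n\<in>admissible L1 L2 d \<epsilon>. energy L1 L2 d \<epsilon> K t n < 0"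
proof -
  define m where "m = measure lebesgue (Omega L1 L2 d)"
  have m: "m > 0" using measure_Omega_pos[OF L d] by (simp add: m_def)
  define R where "R = L1 + L2 + d"
  have R: "R > 0" using L d by (simp add: R_def)
  define C where "C = K * (16 * pi * R\<^sup>2)"
  have C: "C > 0" using K R by (simp add: C_def)
  \<comment> \<open>Each lateral direction has \<open>2 * R / h \<le> 8 * R * t + 2 * R / L\<close>.
    For \<open>t > 1\<close> the constants are absorbed into the linear term, so
    \<open>A * t\<close> bounds the number of planes.\<close>
  define A where "A = 16 * R + 2 * R / L1 + 2 * R / L2 + 10"
  have A: "A > 0" using R L by (simp add: A_def add_pos_pos)
  \<comment> \<open>For \<open>t\<close> beyond \<open>4 * C * A / m\<close> the gain
    \<open>t\<^sup>2 / 4 * m\<close> exceeds the cost \<open>C * A * t\<close>; the summand 1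
    ensures \<open>t > 1\<close>.\<close>
  define tbar where "tbar = 1 + 4 * C * A / m"
  have tbar: "tbar \<ge> 1" "4 * C * A / m < tbar" using m C A by (simp_all add: tbar_def)
  have "\<exists>n\<in>admissible L1 L2 d \<epsilon>. energy L1 L2 d \<epsilon> K t n < 0" if tt: "t > tbar" for t
  proof -
    have t1: "t > 1" using tt tbar by linarith
    have cell: "\<exists>k h. L = real k * h \<and> h > 0 \<and> t * h \<le> 1 / 4 \<and> 2 * R / h \<le> 8 * R * t + 2 * R / L"
      if L: "L > 0" for L
    proof -
      \<comment> \<open>The least number of columns with \<open>L / k \<le> 1 / (4 * t)\<close>.
        Rounding up adds at most one, which keeps \<open>1 / h\<close> below
        \<open>4 * t + 1 / L\<close>.\<close>
      define k where "k = nat \<lceil>4 * t * L\<rceil>"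
      have tL: "4 * t * L > 0" using t1 L by simp
      have k: "4 * t * L \<le> real k" "real k \<le> 4 * t * L + 1"
        using tL by (auto simp: k_def of_nat_nat)
      then have k0: "real k > 0" using tL by linarith
      have "t * (L / real k) \<le> 1 / 4" using k k0 by (simp add: field_simps)
      moreover have "2 * R / (L / real k) \<le> 8 * R * t + 2 * R / L"
      proof -
        have "2 * R / (L / real k) = 2 * R / L * real k" by simp
        also have "\<dots> \<le> 2 * R / L * (4 * t * L + 1)"
          using R L k by (intro mult_left_mono) auto
        also have "\<dots> = 8 * R * t + 2 * R / L" using L by (simp add: field_simps)
        finally show ?thesis .
      qed
      ultimately show ?thesis
        using k0 L by (intro exI[of _ k] exI[of _ "L / real k"]) auto
    qed
    obtain k1 h1 where 1: "L1 = real k1 * h1" "h1 > 0" "t * h1 \<le> 1 / 4" "2 * R / h1 \<le> 8 * R * t + 2 * R / L1"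
      using cell[OF L(1)] by blast
    obtain k2 h2 where 2: "L2 = real k2 * h2" "h2 > 0" "t * h2 \<le> 1 / 4" "2 * R / h2 \<le> 8 * R * t + 2 * R / L2"
      using cell[OF L(2)] by blast
    interpret double_twist d t h1 h2
      using d t1 1 2 by unfold_locales auto
    have "energy L1 L2 d \<epsilon> K t field \<le> - (t\<^sup>2 / 4) * m + K * ((2 * R / h1 + 2 * R / h2 + 10) * (16 * pi * R\<^sup>2))"
      unfolding m_def by (rule energy_field_le[OF 1(1) 2(1) L K R_def])
    also have "K * ((2 * R / h1 + 2 * R / h2 + 10) * (16 * pi * R\<^sup>2)) = C * (2 * R / h1 + 2 * R / h2 + 10)"
      by (simp add: C_def)
    also have "C * (2 * R / h1 + 2 * R / h2 + 10) \<le> C * (A * t)"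
    proof (rule mult_left_mono)
      have "2 * R / h1 + 2 * R / h2 + 10 \<le> 16 * R * t + (2 * R / L1 + 2 * R / L2 + 10) * 1"
        using 1(4) 2(4) by simp
      also have "\<dots> \<le> 16 * R * t + (2 * R / L1 + 2 * R / L2 + 10) * t"
        using t1 R L by (intro add_left_mono mult_left_mono) auto
      finally show "2 * R / h1 + 2 * R / h2 + 10 \<le> A * t"
        by (simp add: A_def algebra_simps)
    qed (use C in simp)
    also have "- (t\<^sup>2 / 4) * m + C * (A * t) < 0"
    proof -
      have "4 * C * A < t * m"
        using tbar tt m by (simp add: pos_divide_less_eq[symmetric])
      then have "t * (4 * C * A) < t * (t * m)"
        using t1 by (intro mult_strict_left_mono) auto
      then show ?thesis by (simp add: power2_eq_square algebra_simps)
    qed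
    finally show ?thesis
      using field_admissible[OF 1(1) 2(1)] by fastforce
  qed
  then show ?thesis using tbar by (intro exI[of _ tbar]) auto
qed

theorem proposition9p5:
  fixes L1 L2 d K \<epsilon> :: real
  assumes "L1 > 0" and "L2 > 0" and "d > 0" and "K > 0" and "\<epsilon> > 0"
  shows "\<exists>tbar>0. \<forall>t>tbar.
           (\<exists>n \<in> admissible L1 L2 d \<epsilon>. energy L1 L2 d \<epsilon> K t n < 0) \<and>
           (\<forall>m \<in> admissible L1 L2 d \<epsilon>.
              depends_only_on_z L1 L2 d m \<longrightarrow> energy L1 L2 d \<epsilon> K t m \<ge> 0)"
proof -
  \<comment> \<open>Nonnegativity holds for every \<open>t\<close>, so the threshold is dictated by
    the competitor alone.\<close>
  have "energy L1 L2 d \<epsilon> K t m \<ge> 0"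
    if "m \<in> admissible L1 L2 d \<epsilon>" "depends_only_on_z L1 L2 d m" for t m
    using that assms(4) by (intro energy_nonneg_depends_only_on_z) (auto simp: admissible_def SBV2_def SBV_def)
  then show ?thesis
    using exists_admissible_energy_neg[OF assms(1-4), of \<epsilon>] by blast
qed

end
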